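(* Let $2\le s\le r$ be fixed integers with $r$ sufficiently large in terms of $s$. If $0<p<1$ is fixed and $\Gamma=G(n,p)$, then with high probability (i.e. with probability tending to $1$ as $n\to\infty$) we have $\mathrm{ex}(\Gamma,\mathcal{P}_{K_{s,r}})=\Theta\big(n^{2-1/s}(\log n)^{1/s}\big)$.
   Context: $G(n,p)$ is the Erdős–Rényi random graph. For a graph $H$, $\mathcal{P}_H$ is the property of not containing $H$ as an induced subgraph, and $\mathrm{ex}(\Gamma,\mathcal{P})$ is the maximum number of edges of a subgraph $G\subseteq\Gamma$ that belongs to $\mathcal{P}$. The implicit constants in $\Theta$ may depend on $s,r,p$. *)

theory Defs
  imports "HOL-Probability.Probability"
begin

text \<open>Simple graphs on the vertex set {0..<n} are represented by their edge sets,
  a set of 2-element subsets of {0..<n}.\<close>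

definition all_pairs :: "nat \<Rightarrow> nat set set" where
  "all_pairs n = {e. \<exists>i j. i < n \<and> j < n \<and> i \<noteq> j \<and> e = {i, j}}"

definition gnp :: "nat \<Rightarrow> real \<Rightarrow> nat set set pmf" where
  "gnp n p = map_pmf (\<lambda>f. {e \<in> all_pairs n. f e})
                     (Pi_pmf (all_pairs n) False (\<lambda>_. bernoulli_pmf p))"

definition has_induced_copy :: "'b set \<Rightarrow> 'b set set \<Rightarrow> nat \<Rightarrow> nat set set \<Rightarrow> bool" where
  "has_induced_copy VH EH n E \<longleftrightarrow>
     (\<exists>\<phi>. inj_on \<phi> VH \<and> \<phi> ` VH \<subseteq> {..<n} \<and>
          (\<forall>u\<in>VH. \<forall>v\<in>VH. u \<noteq> v \<longrightarrow> ({u, v} \<in> EH \<longleftrightarrow> {\<phi> u, \<phi> v} \<in> E)))"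

definition Kbip_V :: "nat \<Rightarrow> nat \<Rightarrow> nat set" where
  "Kbip_V s r = {..<s + r}"

definition Kbip_E :: "nat \<Rightarrow> nat \<Rightarrow> nat set set" where
  "Kbip_E s r = {e. \<exists>i j. i < s \<and> s \<le> j \<and> j < s + r \<and> e = {i, j}}"

definition ex_induced :: "'b set \<Rightarrow> 'b set set \<Rightarrow> nat \<Rightarrow> nat set set \<Rightarrow> nat" where
  "ex_induced VH EH n \<Gamma> = Max {card E | E. E \<subseteq> \<Gamma> \<and> \<not> has_induced_copy VH EH n E}"

end

theory Submission
  imports "HOL-Algebra.Algebraic_Closure_Type" "HOL-Real_Asymp.Real_Asymp" Defs
begin

text \<open>With high probability every vertex set \<open>W\<close> of size at least a constant times \<open>ln n\<close> spans at least
  \<open>\<delta> |W|\<^sup>2\<close> ordered edges and as many ordered non-edges of \<open>\<Gamma>\<close>; everything else is deterministic.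

  Upper bound: if \<open>E \<subseteq> \<Gamma>\<close> has no induced \<open>K\<^bsub>s,r\<^esub>\<close>, then the common neighbourhood in \<open>E\<close> of an independent
  \<open>s\<close>-tuple of \<open>\<Gamma>\<close> contains no independent \<open>r\<close>-set of \<open>\<Gamma>\<close>, so it has size \<open>O(ln n)\<close>. A positive proportion
  of the \<open>s\<close>-tuples in each large neighbourhood is independent, and double counting in the style of
  Kovari, Sos and Turan gives the bound.

  Lower bound: half of the vertices are covered by cliques (blobs) of \<open>\<Gamma>\<close> of size about \<open>ln n\<close>. The pairs
  of blobs are coloured with about \<open>(n / ln n)\<^bsup>1/s\<^esup>\<close> colours by the norm construction of Kollar,
  Ronyai and Szabo, so that no colour class contains \<open>K\<^bsub>s,t\<^esub>\<close> for a constant \<open>t\<close>. The edges of \<open>\<Gamma>\<close> inside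
  blobs together with those in one colour class contain no induced \<open>K\<^bsub>s,r\<^esub>\<close> once \<open>r > s + t\<close>.\<close>

section \<open>Systems of product equations\<close>

text \<open>Gaussian elimination: an equation with a nonzero coefficient is solved for the unknown
  \<open>z0\<close> and substituted into the others. It supplies weights on points that annihilate a
  given finite list of monomials.\<close>

lemma exists_nontrivial_solution:
  fixes f :: "'b \<Rightarrow> 'z \<Rightarrow> 'a::field"
  assumes "finite A" "finite Z" "card A < card Z"
  shows "\<exists>l. (\<exists>z\<in>Z. l z \<noteq> 0) \<and> (\<forall>a\<in>A. (\<Sum>z\<in>Z. l z * f a z) = 0)"
  using assms
proof (induction A arbitrary: Z f rule: finite_induct)
  case empty
  then obtain z where "z \<in> Z"
    by fastforce
  then show ?case
    by (intro exI[of _ "\<lambda>_. 1"]) auto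
next
  case (insert a A)
  show ?case
  proof (cases "\<forall>z\<in>Z. f a z = 0")
    case True
    moreover obtain l where "\<exists>z\<in>Z. l z \<noteq> 0" "\<forall>b\<in>A. (\<Sum>z\<in>Z. l z * f b z) = 0"
      using insert.IH[of Z f] insert.prems insert.hyps by auto
    ultimately show ?thesis
      by (intro exI[of _ l]) auto
  next
    case False
    then obtain z0 where z0: "z0 \<in> Z" "f a z0 \<noteq> 0"
      by blast
    define Z' where "Z' = Z - {z0}"
    have Z': "finite Z'" "Z = insert z0 Z'" "z0 \<notin> Z'"
      using z0 insert.prems by (auto simp: Z'_def)
    \<comment> \<open>These are the coefficients of equation \<open>b\<close> after
      \<open>z0\<close> has been eliminated with the help of equation \<open>a\<close>;
      \<open>c\<close> below is the value of the unknown \<open>z0\<close> that equation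
      \<open>a\<close> forces.\<close>
    define g where "g b z = f b z - f a z / f a z0 * f b z0" for b z
    have "card A < card Z'"
      using insert.prems insert.hyps Z' by simp
    from insert.IH[OF Z'(1) this, of g] obtain l where
      l: "\<exists>z\<in>Z'. l z \<noteq> 0" "\<forall>b\<in>A. (\<Sum>z\<in>Z'. l z * g b z) = 0"
      by blast
    define c where "c = - (\<Sum>z\<in>Z'. l z * f a z) / f a z0"
    define l' where "l' = l(z0 := c)"
    have sum_l': "(\<Sum>z\<in>Z. l' z * h z) = c * h z0 + (\<Sum>z\<in>Z'. l z * h z)" for h
    proof -
      have "(\<Sum>z\<in>Z'. l' z * h z) = (\<Sum>z\<in>Z'. l z * h z)"
        using Z' by (intro sum.cong) (auto simp: l'_def)
      with Z' show ?thesis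
        by (simp add: l'_def)
    qed
    have "(\<Sum>z\<in>Z. l' z * f a z) = 0"
      using z0 by (simp add: sum_l' c_def)
    moreover have "(\<Sum>z\<in>Z. l' z * f b z) = 0" if "b \<in> A" for b
    proof -
      have "(\<Sum>z\<in>Z'. l z * g b z)
          = (\<Sum>z\<in>Z'. l z * f b z) - (\<Sum>z\<in>Z'. l z * f a z * (f b z0 / f a z0))"
        unfolding sum_subtractf[symmetric] by (intro sum.cong) (auto simp: g_def field_simps)
      also have "(\<Sum>z\<in>Z'. l z * f a z * (f b z0 / f a z0)) = - c * f b z0"
        unfolding sum_distrib_right[symmetric] by (simp add: c_def)
      finally show ?thesis
        using l(2) that by (simp add: sum_l' add.commute)
    qed
    moreover have "\<exists>z\<in>Z. l' z \<noteq> 0"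
      using l(1) Z' by (auto simp: l'_def)
    ultimately show ?thesis
      by (intro exI[of _ l']) auto
  qed
qed

section \<open>Lagrange interpolation and moments of weighted point sets\<close>

definition lagrange_basis :: "(nat \<Rightarrow> 'a::field) \<Rightarrow> nat \<Rightarrow> nat \<Rightarrow> 'a \<Rightarrow> 'a" where
  "lagrange_basis d s i t = (\<Prod>k\<in>{..<s}-{i}. (t - d k) / (d i - d k))"

text \<open>The sum is a polynomial of degree at most \<open>s - 1\<close> that equals 1 at the
  \<open>s\<close> distinct nodes, so it is constant.\<close>

lemma sum_lagrange_basis:
  fixes d :: "nat \<Rightarrow> 'a::field"
  assumes "inj_on d {..<s}" "s > 0"
  shows "(\<Sum>i<s. lagrange_basis d s i t) = 1"
proof -
  define p where "p = (\<Sum>i<s. \<Prod>k\<in>{..<s}-{i}. [:- d k / (d i - d k), 1 / (d i - d k):])"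
  have poly_p: "poly p x = (\<Sum>i<s. lagrange_basis d s i x)" for x
    by (simp add: p_def lagrange_basis_def poly_sum poly_prod diff_divide_distrib)
  have "degree p \<le> s - 1"
    unfolding p_def
  proof (intro degree_sum_le)
    fix i assume i: "i \<in> {..<s}"
    have "degree (\<Prod>k\<in>{..<s}-{i}. [:- d k / (d i - d k), 1 / (d i - d k):])
        \<le> (\<Sum>k\<in>{..<s}-{i}. degree [:- d k / (d i - d k), 1 / (d i - d k):])"
      by (rule degree_prod_sum_le[unfolded comp_def]) auto
    also have "\<dots> \<le> (\<Sum>k\<in>{..<s}-{i}. 1)"
      by (intro sum_mono) auto
    finally show "degree (\<Prod>k\<in>{..<s}-{i}. [:- d k / (d i - d k), 1 / (d i - d k):]) \<le> s - 1"
      using i by simp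
  qed auto
  moreover have "poly p (d m) = 1" if m: "m < s" for m
  proof -
    have "(\<Sum>i<s. lagrange_basis d s i (d m)) = (\<Sum>i<s. if i = m then 1 else 0)"
    proof (intro sum.cong refl)
      fix i assume i: "i \<in> {..<s}"
      show "lagrange_basis d s i (d m) = (if i = m then 1 else 0)"
      proof (cases "i = m")
        case True
        have "lagrange_basis d s i (d m) = (\<Prod>k\<in>{..<s}-{i}. 1)"
          unfolding lagrange_basis_def
        proof (intro prod.cong refl)
          fix k assume "k \<in> {..<s} - {i}"
          with True m assms(1) have "d m \<noteq> d k"
            by (auto simp: inj_on_def)
          with True show "(d m - d k) / (d i - d k) = 1"
            by simp
        qed
        with True show ?thesis
          by simp
      next
        case False
        with m show ?thesis
          by (auto simp: lagrange_basis_def intro!: bexI[of _ m])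
      qed
    qed
    with m show ?thesis
      by (simp add: poly_p)
  qed
  ultimately have "p = 1"
    using assms by (intro poly_eqI_degree[where A = "d ` {..<s}"]) (auto simp: card_image)
  with poly_p[of t] show ?thesis
    by simp
qed

text \<open>Multiplying out the univariate factors leaves a combination of weighted sums of
  monomials. The bound \<open>e j\<close> may exceed the degree of \<open>p j\<close>, so that one
  box of exponents serves several products.\<close>

lemma sum_prod_poly_expand:
  fixes x :: "'z \<Rightarrow> nat \<Rightarrow> 'a::field"
  assumes "\<And>j. j < s \<Longrightarrow> degree (p j) \<le> e j"
  shows "(\<Sum>z\<in>Z. l z * (\<Prod>j<s. poly (p j) (x z j)))
       = (\<Sum>a\<in>PiE {..<s} (\<lambda>j. {..e j}).
            (\<Prod>j<s. Polynomial.coeff (p j) (a j)) * (\<Sum>z\<in>Z. l z * (\<Prod>j<s. x z j ^ a j)))"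
proof -
  have "(\<Prod>j<s. poly (p j) (x z j))
      = (\<Sum>a\<in>PiE {..<s} (\<lambda>j. {..e j}). \<Prod>j<s. Polynomial.coeff (p j) (a j) * x z j ^ a j)" for z
  proof -
    have "poly (p j) t = (\<Sum>k\<le>e j. Polynomial.coeff (p j) k * t ^ k)" if "j < s" for j t
      using poly_as_sum_of_monoms'[OF assms[OF that]]
      by (metis (no_types, lifting) poly_monom poly_sum sum.cong)
    then have "(\<Prod>j<s. poly (p j) (x z j))
        = (\<Prod>j<s. \<Sum>k\<in>{..e j}. Polynomial.coeff (p j) k * x z j ^ k)"
      by simp
    then show ?thesis
      by (simp add: prod_sum_PiE)
  qed
  then have "(\<Sum>z\<in>Z. l z * (\<Prod>j<s. poly (p j) (x z j)))
      = (\<Sum>z\<in>Z. \<Sum>a\<in>PiE {..<s} (\<lambda>j. {..e j}).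
          (\<Prod>j<s. Polynomial.coeff (p j) (a j)) * (l z * (\<Prod>j<s. x z j ^ a j)))"
    by (simp add: sum_distrib_left prod.distrib mult_ac)
  also have "\<dots> = (\<Sum>a\<in>PiE {..<s} (\<lambda>j. {..e j}). \<Sum>z\<in>Z.
          (\<Prod>j<s. Polynomial.coeff (p j) (a j)) * (l z * (\<Prod>j<s. x z j ^ a j)))"
    by (rule sum.swap)
  finally show ?thesis
    by (simp add: sum_distrib_left)
qed

text \<open>The weights \<open>l\<close> act as a linear functional that sends a polynomial in
  \<open>s\<close> variables to its weighted sum over the points \<open>x z\<close>. A moment is its
  value at the monomial with exponent vector \<open>a\<close>.\<close>

definition moment :: "('z \<Rightarrow> 'a::field) \<Rightarrow> ('z \<Rightarrow> nat \<Rightarrow> 'a) \<Rightarrow> 'z set \<Rightarrow> nat \<Rightarrow> (nat \<Rightarrow> nat) \<Rightarrow> 'a" where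
  "moment l x Z s a = (\<Sum>z\<in>Z. l z * (\<Prod>j<s. x z j ^ a j))"

lemma moment_cong:
  assumes "\<And>j. j < s \<Longrightarrow> a j = a' j"
  shows "moment l x Z s a = moment l x Z s a'"
  unfolding moment_def using assms by (intro sum.cong arg_cong2[where f = "(*)"] prod.cong) auto

lemma sum_prod_poly_eq_0:
  fixes x :: "'z \<Rightarrow> nat \<Rightarrow> 'a::field"
  assumes "\<And>j. j < s \<Longrightarrow> degree (p j) \<le> e j"
    and "\<And>a. (\<And>j. j < s \<Longrightarrow> a j \<le> e j) \<Longrightarrow> moment l x Z s a = 0"
  shows "(\<Sum>z\<in>Z. l z * (\<Prod>j<s. poly (p j) (x z j))) = 0"
proof -
  have "moment l x Z s a = 0" if "a \<in> PiE {..<s} (\<lambda>j. {..e j})" for a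
    using that by (intro assms(2)) (auto simp: PiE_def Pi_def)
  then show ?thesis
    by (simp add: sum_prod_poly_expand[where e = e, OF assms(1)] moment_def[symmetric])
qed

lemma degree_prod_linear: "degree (\<Prod>k\<in>A. [:- d k, 1:] :: 'a::field poly) = card A"
  by (cases "finite A") (simp_all add: degree_prod_eq_sum_degree)

lemma lead_coeff_prod_linear: "lead_coeff (\<Prod>k\<in>A. [:- d k, 1:] :: 'a::field poly) = 1"
  by (simp add: lead_coeff_prod)

text \<open>The Lagrange basis polynomials sum to 1. Multiplying these identities over the coordinates
  outside \<open>J\<close> gives a sum over maps \<open>\<sigma>\<close> to the \<open>s\<close> equations, and each \<open>\<sigma>\<close> misses some equation \<open>i\<close>,
  whose factors can then be traded for the constant \<open>b i\<close>. This bounds the degree in every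
  coordinate of \<open>J\<close> by \<open>s - 1\<close>.\<close>

lemma prod_linear_factors_expand:
  fixes d :: "nat \<Rightarrow> nat \<Rightarrow> 'a::field"
  assumes inj: "\<And>j. j < s \<Longrightarrow> inj_on (\<lambda>i. d i j) {..<s}"
    and J: "J \<subseteq> {..<s}" "J \<noteq> {}"
  shows "\<exists>m c. (\<forall>\<sigma>. m \<sigma> < s) \<and> (\<forall>t b. (\<forall>i<s. (\<Prod>j<s. t j - d i j) = b i) \<longrightarrow>
       (\<Prod>j\<in>J. \<Prod>i<s. t j - d i j) =
       (\<Sum>\<sigma>\<in>PiE ({..<s} - J) (\<lambda>_. {..<s}). c \<sigma> * b (m \<sigma>) *
          (\<Prod>j<s. \<Prod>k\<in>{..<s} - (if j \<in> J then {m \<sigma>} else {m \<sigma>, \<sigma> j}). t j - d k j)))"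
proof -
  define Jc where "Jc = {..<s} - J"
  have fin: "finite J" "finite Jc" and split: "{..<s} = J \<union> Jc" "J \<inter> Jc = {}"
    using J finite_subset[OF J(1)] by (auto simp: Jc_def)
  have "s > 0"
    using J by (cases s) auto
  have card_Jc: "card Jc < s"
    using J fin \<open>s > 0\<close> by (simp add: Jc_def card_Diff_subset card_gt_0_iff)
  define S where "S = PiE Jc (\<lambda>_. {..<s})"
  have "\<exists>i<s. i \<notin> \<sigma> ` Jc" for \<sigma> :: "nat \<Rightarrow> nat"
  proof (rule ccontr)
    assume "\<not> ?thesis"
    then have "{..<s} \<subseteq> \<sigma> ` Jc"
      by auto
    then have "s \<le> card (\<sigma> ` Jc)"
      using card_mono[of "\<sigma> ` Jc" "{..<s}"] fin by simp
    with card_image_le[of Jc \<sigma>] card_Jc fin show False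
      by simp
  qed
  then obtain m where m: "\<And>\<sigma>. m \<sigma> < s" "\<And>\<sigma>. m \<sigma> \<notin> \<sigma> ` Jc"
    by metis
  \<comment> \<open>All denominators of the Lagrange factors are collected in
    \<open>c \<sigma>\<close>, which does not depend on the point \<open>t\<close>.\<close>
  define c where "c \<sigma> = (\<Prod>j\<in>Jc. \<Prod>k\<in>{..<s}-{\<sigma> j}. 1 / (d (\<sigma> j) j - d k j))" for \<sigma>
  have "(\<Prod>j\<in>J. \<Prod>i<s. t j - d i j) =
       (\<Sum>\<sigma>\<in>S. c \<sigma> * b (m \<sigma>) *
          (\<Prod>j<s. \<Prod>k\<in>{..<s} - (if j \<in> J then {m \<sigma>} else {m \<sigma>, \<sigma> j}). t j - d k j))"
    if eqs: "\<And>i. i < s \<Longrightarrow> (\<Prod>j<s. t j - d i j) = b i" for t b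
  proof -
    have "(\<Prod>j\<in>Jc. \<Sum>i<s. lagrange_basis (\<lambda>i. d i j) s i (t j)) = 1"
      using inj \<open>s > 0\<close> by (intro prod.neutral ballI sum_lagrange_basis) (auto simp: Jc_def)
    then have "(\<Prod>j\<in>J. \<Prod>i<s. t j - d i j) =
        (\<Prod>j\<in>J. \<Prod>i<s. t j - d i j) * (\<Sum>\<sigma>\<in>S. \<Prod>j\<in>Jc. lagrange_basis (\<lambda>i. d i j) s (\<sigma> j) (t j))"
      by (simp add: prod_sum_PiE fin S_def)
    also have "\<dots> = (\<Sum>\<sigma>\<in>S. (\<Prod>j\<in>J. \<Prod>i<s. t j - d i j) *
        (\<Prod>j\<in>Jc. lagrange_basis (\<lambda>i. d i j) s (\<sigma> j) (t j)))"
      by (rule sum_distrib_left)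
    also have "\<dots> = (\<Sum>\<sigma>\<in>S. c \<sigma> * b (m \<sigma>) *
          (\<Prod>j<s. \<Prod>k\<in>{..<s} - (if j \<in> J then {m \<sigma>} else {m \<sigma>, \<sigma> j}). t j - d k j))"
    proof (intro sum.cong refl)
      fix \<sigma> assume \<sigma>: "\<sigma> \<in> S"
      define i where "i = m \<sigma>"
      have i: "i < s"
        using m(1) by (simp add: i_def)
      have "(\<Prod>k<s. t j - d k j) = (t j - d i j) * (\<Prod>k\<in>{..<s}-{i}. t j - d k j)" for j
        using i by (subst prod.remove[of _ i]) auto
      then have eJ: "(\<Prod>j\<in>J. \<Prod>k<s. t j - d k j)
          = (\<Prod>j\<in>J. t j - d i j) * (\<Prod>j\<in>J. \<Prod>k\<in>{..<s}-{i}. t j - d k j)"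
        by (simp add: prod.distrib)
      have "lagrange_basis (\<lambda>i. d i j) s (\<sigma> j) (t j)
          = (\<Prod>k\<in>{..<s}-{\<sigma> j}. 1 / (d (\<sigma> j) j - d k j)) *
            ((t j - d i j) * (\<Prod>k\<in>{..<s}-{i, \<sigma> j}. t j - d k j))" if "j \<in> Jc" for j
      proof -
        have "i \<noteq> \<sigma> j"
          using m(2)[of \<sigma>] that by (auto simp: i_def)
        then have "(\<Prod>k\<in>{..<s}-{\<sigma> j}. t j - d k j)
            = (t j - d i j) * (\<Prod>k\<in>{..<s}-{\<sigma> j}-{i}. t j - d k j)"
          using i by (intro prod.remove) auto
        moreover have "{..<s}-{\<sigma> j}-{i} = {..<s}-{i, \<sigma> j}"
          by auto
        ultimately show ?thesis
          by (simp add: lagrange_basis_def prod_dividef)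
      qed
      then have eJc: "(\<Prod>j\<in>Jc. lagrange_basis (\<lambda>i. d i j) s (\<sigma> j) (t j))
          = c \<sigma> * ((\<Prod>j\<in>Jc. t j - d i j) * (\<Prod>j\<in>Jc. \<Prod>k\<in>{..<s}-{i, \<sigma> j}. t j - d k j))"
        by (simp add: prod.distrib c_def)
      have b_i: "b i = (\<Prod>j\<in>J. t j - d i j) * (\<Prod>j\<in>Jc. t j - d i j)"
        using eqs[OF i] prod.union_disjoint[OF fin split(2), of "\<lambda>j. t j - d i j"] split(1) by simp
      have b_eq: "(\<Prod>j<s. \<Prod>k\<in>{..<s} - (if j \<in> J then {i} else {i, \<sigma> j}). t j - d k j)
          = (\<Prod>j\<in>J. \<Prod>k\<in>{..<s}-{i}. t j - d k j) * (\<Prod>j\<in>Jc. \<Prod>k\<in>{..<s}-{i, \<sigma> j}. t j - d k j)"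
        (is "(\<Prod>j<s. ?g j) = _")
      proof -
        have "(\<Prod>j<s. ?g j) = (\<Prod>j\<in>J. ?g j) * (\<Prod>j\<in>Jc. ?g j)"
          using prod.union_disjoint[OF fin split(2), of ?g] split(1) by simp
        moreover have "(\<Prod>j\<in>Jc. ?g j) = (\<Prod>j\<in>Jc. \<Prod>k\<in>{..<s}-{i, \<sigma> j}. t j - d k j)"
          using split(2) by (intro prod.cong) auto
        ultimately show ?thesis
          by simp
      qed
      show "(\<Prod>j\<in>J. \<Prod>i<s. t j - d i j) *
          (\<Prod>j\<in>Jc. lagrange_basis (\<lambda>i. d i j) s (\<sigma> j) (t j)) = c \<sigma> * b (m \<sigma>) *
          (\<Prod>j<s. \<Prod>k\<in>{..<s} - (if j \<in> J then {m \<sigma>} else {m \<sigma>, \<sigma> j}). t j - d k j)"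
        unfolding eJ eJc i_def[symmetric] b_eq b_i by (simp only: mult_ac)
    qed
    finally show ?thesis .
  qed
  with m(1) show ?thesis
    unfolding S_def Jc_def by blast
qed

text \<open>The monomial with exponents \<open>a\<close> is the leading term of the product of the
  \<open>p j\<close>, whose other monomials are killed by \<open>lower\<close>. On \<open>Z\<close>
  the equations turn that product into a combination of products of the \<open>r \<sigma> j\<close>,
  of smaller degree in each coordinate of \<open>J\<close> and at most \<open>s\<close> higher
  elsewhere; \<open>trade\<close> kills these.\<close>

lemma moment_eq_0_step:
  fixes d :: "nat \<Rightarrow> nat \<Rightarrow> 'a::field" and x :: "'z \<Rightarrow> nat \<Rightarrow> 'a"
  assumes inj: "\<And>j. j < s \<Longrightarrow> inj_on (\<lambda>i. d i j) {..<s}"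
    and eqs: "\<And>z i. z \<in> Z \<Longrightarrow> i < s \<Longrightarrow> (\<Prod>j<s. x z j - d i j) = b i"
    and J: "J \<subseteq> {..<s}" "J \<noteq> {}" "\<And>j. j \<in> J \<Longrightarrow> s \<le> a j"
    and lower: "\<And>a'. (\<And>j. j < s \<Longrightarrow> a' j \<le> a j) \<Longrightarrow> \<exists>j<s. a' j \<noteq> a j \<Longrightarrow> moment l x Z s a' = 0"
    and trade: "\<And>a'. (\<And>j. j \<in> J \<Longrightarrow> a' j < a j) \<Longrightarrow>
      (\<And>j. j < s \<Longrightarrow> j \<notin> J \<Longrightarrow> a' j \<le> a j + s) \<Longrightarrow> moment l x Z s a' = 0"
  shows "moment l x Z s a = 0"
proof -
  obtain m c where m: "\<And>\<sigma>. m \<sigma> < s"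
    and expand: "\<And>t b. (\<forall>i<s. (\<Prod>j<s. t j - d i j) = b i) \<Longrightarrow>
       (\<Prod>j\<in>J. \<Prod>i<s. t j - d i j) =
       (\<Sum>\<sigma>\<in>PiE ({..<s} - J) (\<lambda>_. {..<s}). c \<sigma> * b (m \<sigma>) *
          (\<Prod>j<s. \<Prod>k\<in>{..<s} - (if j \<in> J then {m \<sigma>} else {m \<sigma>, \<sigma> j}). t j - d k j))"
    using prod_linear_factors_expand[where d = d, OF inj J(1,2)] by blast
  define S where "S = PiE ({..<s} - J) (\<lambda>_. {..<s})"
  \<comment> \<open>For \<open>j\<close> in \<open>J\<close>, \<open>s\<close> powers of the
    variable are exchanged for the monic product of the \<open>s\<close> linear factors; this keeps
    the degree \<open>a j\<close>.\<close>
  define a0 where "a0 j = (if j \<in> J then a j - s else a j)" for j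
  define p where "p j = Polynomial.monom 1 (a0 j) *
      (if j \<in> J then \<Prod>i<s. [:- d i j, 1:] else 1)" for j
  define r where "r \<sigma> j = Polynomial.monom 1 (a0 j) *
      (\<Prod>k\<in>{..<s} - (if j \<in> J then {m \<sigma>} else {m \<sigma>, \<sigma> j}). [:- d k j, 1:])" for \<sigma> j
  have monic: "lead_coeff (p j) = 1" for j
    by (cases "j \<in> J") (simp_all only: p_def if_True if_False lead_coeff_mult lead_coeff_monom
        lead_coeff_prod_linear lead_coeff_1 mult_1_right)
  have deg_p: "degree (p j) = a j" for j
    using J(3)[of j]
    by (auto simp: p_def a0_def degree_mult_eq degree_monom_eq degree_prod_linear)
  then have coeff_p: "Polynomial.coeff (p j) (a j) = 1" for j
    using monic[of j] by simp
  have p_nonlead: "moment l x Z s a' = 0" if "a' \<in> PiE {..<s} (\<lambda>j. {..a j}) - {restrict a {..<s}}" for a'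
  proof (rule lower)
    show "\<exists>j<s. a' j \<noteq> a j"
    proof (rule ccontr)
      assume "\<not> ?thesis"
      then have "a' = restrict a {..<s}"
        using that by (intro extensionalityI[of _ "{..<s}"]) (auto simp: PiE_def)
      with that show False
        by blast
    qed
  qed (use that in \<open>auto simp: PiE_def Pi_def\<close>)
  have "(\<Sum>z\<in>Z. l z * (\<Prod>j<s. poly (p j) (x z j)))
      = (\<Sum>a'\<in>PiE {..<s} (\<lambda>j. {..a j}). (\<Prod>j<s. Polynomial.coeff (p j) (a' j)) * moment l x Z s a')"
    unfolding moment_def using deg_p by (intro sum_prod_poly_expand) auto
  also have "\<dots> = (\<Sum>a'\<in>{restrict a {..<s}}. (\<Prod>j<s. Polynomial.coeff (p j) (a' j)) * moment l x Z s a')"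
    using p_nonlead by (intro sum.mono_neutral_right) (auto intro!: finite_PiE)
  also have "\<dots> = moment l x Z s (restrict a {..<s})"
    by (simp add: coeff_p)
  also have "\<dots> = moment l x Z s a"
    by (rule moment_cong) auto
  finally have "moment l x Z s a = (\<Sum>z\<in>Z. l z * (\<Prod>j<s. poly (p j) (x z j)))" ..
  also have "\<dots> = (\<Sum>z\<in>Z. l z * (\<Sum>\<sigma>\<in>S. c \<sigma> * b (m \<sigma>) * (\<Prod>j<s. poly (r \<sigma> j) (x z j))))"
  proof (intro sum.cong refl arg_cong2[where f = "(*)"])
    fix z assume "z \<in> Z"
    then have eqs_z: "\<forall>i<s. (\<Prod>j<s. x z j - d i j) = b i"
      using eqs by blast
    have poly_r: "(\<Prod>j<s. poly (r \<sigma> j) (x z j)) = (\<Prod>j<s. x z j ^ a0 j) *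
        (\<Prod>j<s. \<Prod>k\<in>{..<s} - (if j \<in> J then {m \<sigma>} else {m \<sigma>, \<sigma> j}). x z j - d k j)" for \<sigma>
      unfolding prod.distrib[symmetric]
      by (intro prod.cong refl) (simp add: r_def poly_monom poly_prod split del: if_split)
    note expand_z = expand[OF eqs_z, folded S_def]
    have "(\<Prod>j<s. poly (p j) (x z j))
        = (\<Prod>j<s. x z j ^ a0 j) * (\<Prod>j<s. if j \<in> J then \<Prod>i<s. x z j - d i j else 1)"
      unfolding prod.distrib[symmetric]
      by (intro prod.cong) (auto simp: p_def poly_monom poly_prod)
    also have "(\<Prod>j<s. if j \<in> J then \<Prod>i<s. x z j - d i j else 1) = (\<Prod>j\<in>J. \<Prod>i<s. x z j - d i j)"
      using J(1) by (simp add: prod.If_cases Int_absorb1)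
    also have "(\<Prod>j<s. x z j ^ a0 j) * \<dots> = (\<Sum>\<sigma>\<in>S. c \<sigma> * b (m \<sigma>) * (\<Prod>j<s. poly (r \<sigma> j) (x z j)))"
      unfolding expand_z sum_distrib_left
      by (intro sum.cong refl) (simp only: poly_r mult_ac)
    finally show "(\<Prod>j<s. poly (p j) (x z j)) = \<dots>" .
  qed
  also have "\<dots> = (\<Sum>\<sigma>\<in>S. c \<sigma> * b (m \<sigma>) * (\<Sum>z\<in>Z. l z * (\<Prod>j<s. poly (r \<sigma> j) (x z j))))"
    unfolding sum_distrib_left by (subst sum.swap) (simp add: mult_ac)
  also have "\<dots> = 0"
  proof (intro sum.neutral ballI)
    fix \<sigma>
    have m_less: "m \<sigma> < s"
      by (rule m)
    have "(\<Sum>z\<in>Z. l z * (\<Prod>j<s. poly (r \<sigma> j) (x z j))) = 0"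
    \<comment> \<open>Omitting the factor with index \<open>m \<sigma>\<close> leaves degree
      \<open>a j - 1\<close> on \<open>J\<close>; off \<open>J\<close> at most \<open>s\<close>
      linear factors have been added.\<close>
    proof (rule sum_prod_poly_eq_0[where e = "\<lambda>j. if j \<in> J then a j - 1 else a j + s"])
      fix j assume "j < s"
      have deg: "degree (r \<sigma> j) = a0 j + card ({..<s} - (if j \<in> J then {m \<sigma>} else {m \<sigma>, \<sigma> j}))"
        unfolding r_def by (subst degree_mult_eq) (auto simp: degree_monom_eq degree_prod_linear)
      have "card ({..<s} - {m \<sigma>, \<sigma> j}) \<le> s"
        using card_mono[of "{..<s}" "{..<s} - {m \<sigma>, \<sigma> j}"] by auto
      with deg J(3)[of j] m_less
      show "degree (r \<sigma> j) \<le> (if j \<in> J then a j - 1 else a j + s)"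
        by (auto simp: a0_def)
    next
      fix a' assume a': "\<And>j. j < s \<Longrightarrow> a' j \<le> (if j \<in> J then a j - 1 else a j + s)"
      show "moment l x Z s a' = 0"
      proof (rule trade)
        fix j assume "j \<in> J"
        then have "j < s" "s \<le> a j"
          using J by auto
        with a'[of j] \<open>j \<in> J\<close> m_less show "a' j < a j"
          by simp
      qed (use a' in \<open>force split: if_splits\<close>)
    qed
    then show "c \<sigma> * b (m \<sigma>) * (\<Sum>z\<in>Z. l z * (\<Prod>j<s. poly (r \<sigma> j) (x z j))) = 0"
      by simp
  qed
  finally show ?thesis .
qed

text \<open>Pigeonhole over the \<open>s\<close> windows of length \<open>g\<close> above \<open>s\<close>: one of them contains no exponent,
  and the exponents above it form \<open>J\<close>.\<close>

lemma exists_gap: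
  fixes a :: "nat \<Rightarrow> nat"
  assumes "j0 < s" "s + s * g \<le> a j0" "g > 0"
  shows "\<exists>J. J \<subseteq> {..<s} \<and> J \<noteq> {} \<and> (\<forall>j\<in>J. s \<le> a j) \<and>
    (\<forall>j\<in>J. \<forall>i<s. i \<notin> J \<longrightarrow> a i + g \<le> a j)"
proof -
  have "\<not> {..<s} \<subseteq> (\<lambda>j. (a j - s) div g) ` ({..<s} - {j0})"
  proof
    assume "{..<s} \<subseteq> (\<lambda>j. (a j - s) div g) ` ({..<s} - {j0})"
    then have "card {..<s} \<le> card ({..<s} - {j0})"
      by (intro surj_card_le) auto
    with assms show False
      by simp
  qed
  then obtain k where k: "k < s" "\<And>j. j < s \<Longrightarrow> j \<noteq> j0 \<Longrightarrow> (a j - s) div g \<noteq> k"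
    by fastforce
  define J where "J = {j. j < s \<and> s + (k + 1) * g \<le> a j}"
  have "(k + 1) * g \<le> s * g"
    using k by (intro mult_le_mono1) auto
  with assms have "j0 \<in> J"
    by (simp add: J_def)
  moreover have "a i + g \<le> a j" if "j \<in> J" "i < s" "i \<notin> J" for i j
  proof -
    have less: "a i < s + (k + 1) * g" and ge: "s + (k + 1) * g \<le> a j"
      using that by (auto simp: J_def)
    have "i \<noteq> j0"
      using that \<open>j0 \<in> J\<close> by auto
    then have "(a i - s) div g \<noteq> k"
      using k that by blast
    moreover have "(a i - s) div g = k" if "s + k * g \<le> a i"
      using that less by (intro div_nat_eqI) (auto simp: algebra_simps)
    ultimately have "a i < s + k * g"
      by (meson not_le)
    with ge show ?thesis
      by simp
  qed
  ultimately show ?thesis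
    by (intro exI[of _ J]) (auto simp: J_def)
qed

text \<open>The weight \<open>\<Sum>j<s. 2 ^ a j\<close> decreases under both kinds of rewriting, so a linear combination
  of evaluations at points of \<open>Z\<close> that kills all monomials with small exponents kills every monomial.
  Hence \<open>Z\<close> has at most as many points as there are such monomials.\<close>

lemma moment_eq_0:
  fixes d :: "nat \<Rightarrow> nat \<Rightarrow> 'a::field" and x :: "'z \<Rightarrow> nat \<Rightarrow> 'a"
  assumes inj: "\<And>j. j < s \<Longrightarrow> inj_on (\<lambda>i. d i j) {..<s}"
    and eqs: "\<And>z i. z \<in> Z \<Longrightarrow> i < s \<Longrightarrow> (\<Prod>j<s. x z j - d i j) = b i"
    and small: "\<And>a. (\<And>j. j < s \<Longrightarrow> a j < s + s * (2 * s + 1)) \<Longrightarrow> moment l x Z s a = 0"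
  shows "moment l x Z s a = 0"
proof (induction "\<Sum>j<s. (2::nat) ^ a j" arbitrary: a rule: less_induct)
  case less
  \<comment> \<open>This width absorbs the increase of an exponent by \<open>s\<close>, a factor
    \<open>2 ^ s\<close> that outweighs the number of coordinates, and one halving.\<close>
  define g where "g = 2 * s + 1"
  then have g_pos: "g > 0"
    by simp
  show ?case
  proof (cases "\<exists>j0<s. s + s * g \<le> a j0")
    case False
    then show ?thesis
      by (intro small) (auto simp: g_def not_le)
  next
    case True
    then obtain j1 where "j1 < s" "s + s * g \<le> a j1"
      by blast
    from exists_gap[where a = a, OF this g_pos] obtain J where
      *: "J \<subseteq> {..<s} \<and> J \<noteq> {} \<and> (\<forall>j\<in>J. s \<le> a j) \<and>
        (\<forall>j\<in>J. \<forall>i<s. i \<notin> J \<longrightarrow> a i + g \<le> a j)" ..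
    then have J: "J \<subseteq> {..<s}" "J \<noteq> {}" "\<And>j. j \<in> J \<Longrightarrow> s \<le> a j"
      by auto
    have gap: "a i + g \<le> a j" if "j \<in> J" "i < s" "i \<notin> J" for i j
      using * that by simp
    obtain j0 where j0: "j0 \<in> J"
      using J by blast
    have fin: "finite J"
      using J(1) finite_subset by blast
    show ?thesis
    proof (rule moment_eq_0_step[OF inj eqs J])
      fix a' assume le: "\<And>j. j < s \<Longrightarrow> a' j \<le> a j" and "\<exists>j<s. a' j \<noteq> a j"
      then obtain j where "j < s" "a' j \<noteq> a j"
        by blast
      with le[of j] have "j < s" "a' j < a j"
        by auto
      then have "(\<Sum>j<s. (2::nat) ^ a' j) < (\<Sum>j<s. 2 ^ a j)"
        using le by (intro sum_strict_mono_ex1) (auto intro!: power_increasing bexI[of _ j])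
      then show "moment l x Z s a' = 0"
        by (rule less)
    next
      fix a' assume dec: "\<And>j. j \<in> J \<Longrightarrow> a' j < a j"
        and inc: "\<And>j. j < s \<Longrightarrow> j \<notin> J \<Longrightarrow> a' j \<le> a j + s"
      \<comment> \<open>On \<open>J\<close> every summand of the weight at least halves. Off
        \<open>J\<close> the new summands together stay below half of \<open>2 ^ a j0\<close>, so
        the new weight is less than the old weight of \<open>J\<close> alone.\<close>
      have "2 * 2 ^ a' j \<le> (2::nat) ^ a j" if "j \<in> J" for j
        using power_increasing[of "Suc (a' j)" "a j" "2::nat"] dec[OF that] by simp
      then have in_J: "2 * (\<Sum>j\<in>J. 2 ^ a' j) \<le> (\<Sum>j\<in>J. (2::nat) ^ a j)"
        unfolding sum_distrib_left by (intro sum_mono) auto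
      have "2 ^ s * (2 * 2 ^ a' j) \<le> (2::nat) ^ a j0" if "j < s" "j \<notin> J" for j
        using power_increasing[of "s + Suc (a' j)" "a j0" "2::nat"] inc[OF that] gap[OF j0 that]
        by (simp add: power_add g_def)
      then have "(\<Sum>j\<in>{..<s}-J. 2 ^ s * (2 * 2 ^ a' j)) \<le> (\<Sum>j\<in>{..<s}-J. (2::nat) ^ a j0)"
        by (intro sum_mono) auto
      also have "\<dots> \<le> s * 2 ^ a j0"
        using card_mono[of "{..<s}" "{..<s} - J"] by simp
      also have "\<dots> < 2 ^ s * 2 ^ a j0"
        by (simp add: less_exp)
      finally have "2 ^ s * (2 * (\<Sum>j\<in>{..<s}-J. 2 ^ a' j)) < (2::nat) ^ s * 2 ^ a j0"
        unfolding sum_distrib_left[symmetric] .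
      then have "2 * (\<Sum>j\<in>{..<s}-J. 2 ^ a' j) < (2::nat) ^ a j0"
        using mult_less_cancel1 by blast
      moreover have "(2::nat) ^ a j0 \<le> (\<Sum>j\<in>J. 2 ^ a j)"
        using j0 fin by (intro member_le_sum) auto
      moreover have "(\<Sum>j\<in>J. (2::nat) ^ a j) \<le> (\<Sum>j<s. 2 ^ a j)"
        using J(1) by (intro sum_mono2) auto
      moreover have "p + q < u"
        if "2 * p \<le> t" "2 * q < w" "w \<le> t" "t \<le> u" for p q t u w :: nat
        using that by simp
      ultimately have "(\<Sum>j\<in>J. 2 ^ a' j) + (\<Sum>j\<in>{..<s}-J. 2 ^ a' j) < (\<Sum>j<s. (2::nat) ^ a j)"
        using in_J by blast
      then have "(\<Sum>j<s. (2::nat) ^ a' j) < (\<Sum>j<s. 2 ^ a j)"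
        unfolding sum.subset_diff[OF J(1) finite_lessThan, of "\<lambda>j. (2::nat) ^ a' j"]
        by (simp only: add.commute)
      then show "moment l x Z s a' = 0"
        by (rule less)
    qed
  qed
qed

text \<open>With more points than exponent vectors in the box, some nontrivial weights make all
  small moments vanish, hence all moments. A polynomial in the first coordinate that vanishes at all
  points but one, which exists as that coordinate is injective, then gives a contradiction.\<close>

theorem card_product_system_le:
  fixes d :: "nat \<Rightarrow> nat \<Rightarrow> 'a::field" and x :: "'z \<Rightarrow> nat \<Rightarrow> 'a"
  assumes "s > 0" "finite Z" and inj_x: "inj_on (\<lambda>z. x z 0) Z"
    and inj: "\<And>j. j < s \<Longrightarrow> inj_on (\<lambda>i. d i j) {..<s}"
    and eqs: "\<And>z i. z \<in> Z \<Longrightarrow> i < s \<Longrightarrow> (\<Prod>j<s. x z j - d i j) = b i"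
  shows "card Z \<le> (s + s * (2 * s + 1)) ^ s"
proof (rule ccontr)
  define A where "A = PiE {..<s} (\<lambda>_. {..<s + s * (2 * s + 1)})"
  assume "\<not> ?thesis"
  then have "card A < card Z"
    by (simp add: A_def card_PiE)
  moreover have "finite A"
    by (simp add: A_def finite_PiE)
  ultimately obtain l where "\<exists>z\<in>Z. l z \<noteq> 0"
    and l: "\<forall>a\<in>A. (\<Sum>z\<in>Z. l z * (\<Prod>j<s. x z j ^ a j)) = 0"
    using exists_nontrivial_solution[of A Z "\<lambda>a z. \<Prod>j<s. x z j ^ a j"] \<open>finite Z\<close>
    by blast
  then obtain z0 where z0: "z0 \<in> Z" "l z0 \<noteq> 0"
    by blast
  have small: "moment l x Z s a = 0" if "\<And>j. j < s \<Longrightarrow> a j < s + s * (2 * s + 1)" for a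
  proof -
    have "restrict a {..<s} \<in> A"
      using that unfolding A_def by auto
    with l have "moment l x Z s (restrict a {..<s}) = 0"
      unfolding moment_def by blast
    moreover have "moment l x Z s (restrict a {..<s}) = moment l x Z s a"
      by (rule moment_cong) auto
    ultimately show ?thesis
      by simp
  qed
  have moments: "moment l x Z s a = 0" for a
    by (rule moment_eq_0[of s d Z x b l a]) (fact inj eqs small)+
  \<comment> \<open>This polynomial isolates the nonzero weight \<open>l z0\<close>.\<close>
  define p where "p = (\<Prod>z\<in>Z-{z0}. [:- x z 0, 1:])"
  define q where "q j = (if j = 0 then p else 1)" for j :: nat
  have "(\<Sum>z\<in>Z. l z * (\<Prod>j<s. poly (q j) (x z j))) = 0"
    by (rule sum_prod_poly_eq_0[where e = "\<lambda>j. degree (q j)"]) (auto intro: moments)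
  moreover have "(\<Prod>j<s. poly (q j) (x z j)) = poly p (x z 0)" for z
  proof -
    have "(\<Prod>j<s. poly (q j) (x z j)) = (\<Prod>j\<in>{0}. poly (q j) (x z j))"
      using \<open>s > 0\<close> by (intro prod.mono_neutral_right) (auto simp: q_def)
    then show ?thesis
      by (simp add: q_def)
  qed
  ultimately have "(\<Sum>z\<in>Z. l z * poly p (x z 0)) = 0"
    by simp
  also have "(\<Sum>z\<in>Z. l z * poly p (x z 0)) = (\<Sum>z\<in>{z0}. l z * poly p (x z 0))"
    using z0 \<open>finite Z\<close> by (intro sum.mono_neutral_right) (auto simp: p_def poly_prod)
  finally have "poly p (x z0 0) = 0"
    using z0 by simp
  then show False
    using \<open>finite Z\<close> inj_x z0 by (auto simp: p_def poly_prod inj_on_def)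
qed

section \<open>Norm colourings\<close>

text \<open>Over an algebraically closed field \<open>p\<close> splits into linear factors, and a
  factor occurring twice would give a common root with the derivative.\<close>

lemma card_roots_eq_degree:
  fixes p :: "'a::alg_closed_field poly"
  assumes "p \<noteq> 0" and simple: "\<And>a. poly p a = 0 \<Longrightarrow> poly (pderiv p) a \<noteq> 0"
  shows "card {a. poly p a = 0} = degree p"
proof -
  obtain A where A: "size A = degree p" "p = smult (lead_coeff p) (\<Prod>x\<in>#A. [:-x, 1:])"
    using alg_closed_imp_factorization[OF assms(1)] by blast
  have roots: "{a. poly p a = 0} = set_mset A"
    using assms(1) by (subst A(2)) (auto simp: poly_prod_mset)
  have "count A a = 1" if "a \<in># A" for a
  proof (rule ccontr)
    assume "count A a \<noteq> 1"
    moreover obtain B where B: "A = add_mset a B"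
      using \<open>a \<in># A\<close> by (metis mset_add)
    ultimately obtain C where C: "A = add_mset a (add_mset a C)"
      by (metis count_add_mset count_inI insert_DiffM2 add_mset_add_single One_nat_def mset_add)
    have "p = [:-a, 1:] * ([:-a, 1:] * smult (lead_coeff p) (\<Prod>x\<in>#C. [:-x, 1:]))"
      by (subst A(2), subst C) simp
    then obtain u r where r: "p = u * (u * r)" "poly u a = 0"
      by fastforce
    have "poly p a = 0" "poly (pderiv p) a = 0"
      using r(2) by (simp_all add: r(1) pderiv_mult)
    with simple show False
      by blast
  qed
  then have "size A = card (set_mset A)"
    by (simp add: size_multiset_overloaded_eq)
  with A roots show ?thesis
    by simp
qed

lemma CHAR_gf2: "CHAR(gf2) = 2"
proof -
  have "(1 :: gf2) + 1 = 0"
    by (simp only: Rep_gf2_inject[symmetric] plus_gf2.rep_eq zero_gf2.rep_eq if_True refl)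
  then have "(of_nat 2 :: gf2) = 0"
    by simp
  then have "CHAR(gf2) dvd 2"
    by (simp only: of_nat_eq_0_iff_char_dvd)
  then show ?thesis
    by (metis CHAR_not_1' One_nat_def prime_nat_iff two_is_prime_nat)
qed

text \<open>Let \<open>q = 2 ^ k\<close> and identify \<open>{..<q ^ s}\<close> with the field of \<open>q ^ s\<close> elements. The colour of \<open>x\<close> and \<open>y\<close> is the norm of
  \<open>x + y\<close> over the field of \<open>q\<close> elements, which is a product of \<open>s\<close> conjugates of \<open>x + y\<close>. Since the
  conjugation \<open>z \<mapsto> z ^ (q ^ j)\<close> is additive, the common neighbours of \<open>s\<close> points in a colour
  class solve a system of product equations.\<close>

theorem norm_colouring:
  assumes "s > 0" "k > 0"
  shows "\<exists>\<kappa> :: nat \<Rightarrow> nat \<Rightarrow> nat. (\<forall>x y. \<kappa> x y = \<kappa> y x) \<and>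
    (\<forall>x<(2 ^ k) ^ s. \<forall>y<(2 ^ k) ^ s. \<kappa> x y < 2 ^ k) \<and>
    (\<forall>S c. S \<subseteq> {..<(2 ^ k) ^ s} \<longrightarrow> card S = s \<longrightarrow>
      card {y. y < (2 ^ k) ^ s \<and> (\<forall>x\<in>S. \<kappa> x y = c)} \<le> (s + s * (2 * s + 1)) ^ s)"
proof -
  define q :: nat where "q = 2 ^ k"
  have q: "q > 1"
    using assms one_less_power[of "2::nat" k] by (simp add: q_def)
  have char: "CHAR(gf2 alg_closure) = 2"
    by (simp add: CHAR_gf2)
  have two: "(2 :: gf2 alg_closure) = 0"
    using of_nat_CHAR[where ?'a = "gf2 alg_closure"] unfolding char by simp
  have minus: "x - y = x + y" for x y :: "gf2 alg_closure"
  proof -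
    have "y + y = 0"
      using two by (metis mult_2 mult_zero_left)
    then show ?thesis
      by (metis add_diff_cancel_right' add.assoc add.right_neutral)
  qed
  have frob: "(x + y) ^ (q ^ j) = x ^ (q ^ j) + y ^ (q ^ j)" for x y :: "gf2 alg_closure" and j
    by (rule freshmans_dream'[where n = "k * j"]) (simp_all add: CHAR_gf2 q_def power_mult)
  have frob_inj: "x = y" if "x ^ (q ^ j) = y ^ (q ^ j)" for x y :: "gf2 alg_closure" and j
  proof -
    have "(x + y) ^ (q ^ j) = y ^ (q ^ j) - y ^ (q ^ j)"
      unfolding frob that minus ..
    then have "x - y = 0"
      by (simp add: minus)
    then show ?thesis
      by simp
  qed
  \<comment> \<open>The field with \<open>q ^ s\<close> elements, realised as the fixed points of an
    iterate of Frobenius. The polynomial \<open>P\<close> below has derivative \<open>- 1\<close>,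
    hence \<open>q ^ s\<close> simple roots.\<close>
  define F where "F = {x :: gf2 alg_closure. x ^ (q ^ s) = x}"
  define P where "P = Polynomial.monom 1 (q ^ s) - [:0, 1 :: gf2 alg_closure:]"
  have qs: "q ^ s > 1"
    using q assms one_less_power[of q s] by simp
  have deg_P: "degree P = q ^ s"
    unfolding P_def diff_conv_add_uminus
    using qs by (subst degree_add_eq_left) (auto simp: degree_monom_eq)
  have "even (q ^ s)"
    using assms by (simp add: q_def)
  then have "(of_nat (q ^ s) :: gf2 alg_closure) = 0"
    by (simp only: of_nat_eq_0_iff_char_dvd char)
  then have "pderiv P = [:- 1:]"
    unfolding P_def by (simp add: pderiv_diff pderiv_monom pderiv_pCons del: of_nat_power)
  then have "card {a. poly P a = 0} = q ^ s"
    using deg_P qs by (subst card_roots_eq_degree) auto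
  moreover have "{a. poly P a = 0} = F"
    by (simp add: F_def P_def poly_monom)
  ultimately have card_F: "card F = q ^ s"
    by simp
  have "finite F"
    by (intro card_ge_0_finite) (use card_F qs in linarith)
  then obtain f where f: "bij_betw f {..<q ^ s} F"
    using ex_bij_betw_nat_finite[of F] card_F by (auto simp: atLeast0LessThan)
  \<comment> \<open>The subfield in which the norms lie; \<open>g\<close> will number its elements
    by colours below \<open>q\<close>.\<close>
  define C where "C = {c :: gf2 alg_closure. c ^ q = c}"
  define Q where "Q = Polynomial.monom 1 q - [:0, 1 :: gf2 alg_closure:]"
  have deg_Q: "degree Q = q"
    unfolding Q_def diff_conv_add_uminus
    using q by (subst degree_add_eq_left) (auto simp: degree_monom_eq)
  have C_eq: "C = {a. poly Q a = 0}"
    by (simp add: C_def Q_def poly_monom)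
  have "Q \<noteq> 0"
    using deg_Q q by auto
  then have C: "finite C" "card C \<le> q"
    using poly_roots_finite[of Q] card_poly_roots_bound[of Q] deg_Q by (auto simp: C_eq)
  then obtain g where g: "inj_on g C" "g ` C \<subseteq> {..<q}"
    using card_le_inj[of C "{..<q}"] by auto
  define N where "N z = (\<Prod>j<s. z ^ (q ^ j))" for z :: "gf2 alg_closure"
  have N_C: "N z \<in> C" if "z \<in> F" for z
  proof -
    \<comment> \<open>Taking the \<open>q\<close>-th power shifts the list of conjugates by one, and
      \<open>z ^ (q ^ s) = z\<close> closes the cycle. The common factor \<open>z\<close> is
      cancelled afterwards, with \<open>z = 0\<close> treated apart.\<close>
    have "N z ^ q = (\<Prod>j<s. z ^ (q ^ Suc j))"
      by (simp add: N_def prod_power_distrib power_mult[symmetric] mult.commute)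
    also have "\<dots> * z ^ (q ^ 0) = N z * z ^ (q ^ s)"
      using prod.lessThan_Suc_shift[of "\<lambda>j. z ^ (q ^ j)" s]
        prod.lessThan_Suc[of "\<lambda>j. z ^ (q ^ j)" s]
      by (simp add: N_def mult.commute)
    finally have "N z ^ q * z = N z * z"
      using that by (simp add: F_def)
    moreover have "N 0 ^ q = N 0"
      using \<open>s > 0\<close> q by (auto simp: N_def power_0_left)
    ultimately show ?thesis
      by (cases "z = 0") (auto simp: C_def)
  qed
  have add_F: "f x + f y \<in> F" if "x < q ^ s" "y < q ^ s" for x y
  proof -
    have "f x \<in> F" "f y \<in> F"
      using f that by (auto simp: bij_betw_def)
    then show ?thesis
      by (simp add: F_def frob)
  qed
  \<comment> \<open>In characteristic 2 sums are differences, so the norm of a difference becomes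
    symmetric in \<open>x\<close> and \<open>y\<close>.\<close>
  define \<kappa> where "\<kappa> x y = g (N (f x + f y))" for x y
  have "\<kappa> x y = \<kappa> y x" for x y
    by (simp add: \<kappa>_def add.commute)
  moreover have "\<kappa> x y < q" if "x < q ^ s" "y < q ^ s" for x y
    using g(2) N_C[OF add_F[OF that]] by (auto simp: \<kappa>_def)
  moreover have "card {y. y < q ^ s \<and> (\<forall>x\<in>S. \<kappa> x y = c)} \<le> (s + s * (2 * s + 1)) ^ s"
    if S: "S \<subseteq> {..<q ^ s}" "card S = s" for S c
  proof -
    have "finite S"
      using S finite_subset by blast
    then obtain h where h: "bij_betw h {..<s} S"
      using ex_bij_betw_nat_finite[of S] S by (auto simp: atLeast0LessThan)
    show ?thesis
    proof (rule card_product_system_le)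
      show "inj_on (\<lambda>y. f y ^ (q ^ 0)) {y. y < q ^ s \<and> (\<forall>x\<in>S. \<kappa> x y = c)}"
        using f by (auto simp: bij_betw_def inj_on_def)
      show "inj_on (\<lambda>i. f (h i) ^ (q ^ j)) {..<s}" for j
      proof (rule inj_onI)
        fix i i' assume i: "i \<in> {..<s}" "i' \<in> {..<s}" and "f (h i) ^ (q ^ j) = f (h i') ^ (q ^ j)"
        then have "f (h i) = f (h i')"
          using frob_inj by blast
        moreover have "h i \<in> {..<q ^ s}" "h i' \<in> {..<q ^ s}"
          using i h S(1) by (auto simp: bij_betw_def)
        ultimately have "h i = h i'"
          using f by (auto simp: bij_betw_def inj_on_def)
        then show "i = i'"
          using h i by (auto simp: bij_betw_def inj_on_def)
      qed
      fix y i assume y: "y \<in> {y. y < q ^ s \<and> (\<forall>x\<in>S. \<kappa> x y = c)}" and i: "i < s"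
      have hi: "h i \<in> S" "h i < q ^ s"
        using h i S(1) by (auto simp: bij_betw_def)
      \<comment> \<open>The colour is decoded into a norm value, the common right-hand side of all
        \<open>s\<close> equations; the unknowns are the conjugates of \<open>f y\<close>.\<close>
      with y have "inv_into C g c = N (f (h i) + f y)"
        using inv_into_f_f[OF g(1) N_C[OF add_F[of "h i" y]]] by (auto simp: \<kappa>_def)
      also have "\<dots> = (\<Prod>j<s. f y ^ (q ^ j) - f (h i) ^ (q ^ j))"
        by (simp add: N_def frob minus add.commute)
      finally show "(\<Prod>j<s. f y ^ (q ^ j) - f (h i) ^ (q ^ j)) = inv_into C g c" ..
    qed (use assms in auto)
  qed
  ultimately show ?thesis
    unfolding q_def[symmetric] by blast
qed

section \<open>Locally dense relations and clique blobs\<close>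

text \<open>One predicate serves both for edges and for non-edges of \<open>\<Gamma>\<close>;
  cliques of the non-edge relation are independent sets. The threshold \<open>m\<close> is real
  because it will be a multiple of \<open>ln n\<close>.\<close>

definition dense_rel :: "('a \<Rightarrow> 'a \<Rightarrow> bool) \<Rightarrow> real \<Rightarrow> real \<Rightarrow> 'a set \<Rightarrow> bool" where
  "dense_rel R \<delta> m V \<longleftrightarrow>
     (\<forall>W\<subseteq>V. m \<le> card W \<longrightarrow> \<delta> * (card W)\<^sup>2 \<le> card {(u, v). u \<in> W \<and> v \<in> W \<and> R u v})"

text \<open>With lists instead of sets, splitting off the head gives a disjoint recursion, so
  cliques are counted by a plain sum over first vertices.\<close>

definition clique_lists :: "('a \<Rightarrow> 'a \<Rightarrow> bool) \<Rightarrow> nat \<Rightarrow> 'a set \<Rightarrow> 'a list set" where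
  "clique_lists R k W = {xs. length xs = k \<and> set xs \<subseteq> W \<and> sorted_wrt R xs}"

lemma finite_clique_lists: "finite W \<Longrightarrow> finite (clique_lists R k W)"
  by (rule finite_subset[OF _ finite_lists_length_eq[of W k]]) (auto simp: clique_lists_def)

lemma clique_lists_Suc:
  "clique_lists R (Suc k) W = (\<Union>v\<in>W. (#) v ` clique_lists R k {w \<in> W. R v w})"
proof (intro Set.set_eqI iffI)
  fix xs assume "xs \<in> clique_lists R (Suc k) W"
  then obtain v ys where "xs = v # ys" "v \<in> W" "ys \<in> clique_lists R k {w \<in> W. R v w}"
    by (cases xs) (auto simp: clique_lists_def)
  then show "xs \<in> (\<Union>v\<in>W. (#) v ` clique_lists R k {w \<in> W. R v w})"
    by blast
qed (auto simp: clique_lists_def)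

lemma card_clique_lists_Suc:
  assumes "finite W"
  shows "card (clique_lists R (Suc k) W) = (\<Sum>v\<in>W. card (clique_lists R k {w \<in> W. R v w}))"
  unfolding clique_lists_Suc
  using assms by (subst card_UN_disjoint) (auto simp: finite_clique_lists card_image)

text \<open>Averaging: vertices below the degree threshold account for at most half of the
  guaranteed ordered pairs, and each remaining vertex for at most \<open>card W\<close>.\<close>

lemma many_vertices_of_large_degree:
  fixes \<delta> :: real
  assumes fin: "finite W" and "0 \<le> \<delta>"
    and dense: "\<delta> * (card W)\<^sup>2 \<le> card {(u, v). u \<in> W \<and> v \<in> W \<and> R u v}"
  shows "\<delta> / 2 * card W \<le> card {v \<in> W. \<delta> / 2 * card W \<le> card {w \<in> W. R v w}}"
proof (cases "W = {}")
  case False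
  define H where "H = {v \<in> W. \<delta> / 2 * card W \<le> card {w \<in> W. R v w}}"
  have H: "finite H" "H \<subseteq> W"
    using fin by (auto simp: H_def)
  have "{(u, v). u \<in> W \<and> v \<in> W \<and> R u v} = (SIGMA v:W. {w \<in> W. R v w})"
    by auto
  then have "card {(u, v). u \<in> W \<and> v \<in> W \<and> R u v} = (\<Sum>v\<in>W. card {w \<in> W. R v w})"
    using fin by simp
  then have "\<delta> * (card W)\<^sup>2 \<le> (\<Sum>v\<in>W. real (card {w \<in> W. R v w}))"
    using dense by simp
  also have "\<dots> = (\<Sum>v\<in>H. real (card {w \<in> W. R v w})) + (\<Sum>v\<in>W-H. real (card {w \<in> W. R v w}))"
    using sum.subset_diff[OF H(2) fin, of "\<lambda>v. real (card {w \<in> W. R v w})"] by simp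
  also have "\<dots> \<le> (\<Sum>v\<in>H. real (card W)) + (\<Sum>v\<in>W-H. \<delta> / 2 * card W)"
    using fin by (intro add_mono sum_mono) (auto simp: H_def intro!: card_mono)
  also have "\<dots> \<le> card H * real (card W) + card W * (\<delta> / 2 * card W)"
    using fin \<open>0 \<le> \<delta>\<close>
    by (auto intro!: mult_right_mono card_mono mult_nonneg_nonneg simp del: times_divide_eq_left)
  finally have "\<delta> / 2 * card W * card W \<le> card H * real (card W)"
    by (simp add: power2_eq_square algebra_simps)
  moreover have "real (card W) > 0"
    using False fin by (simp add: card_gt_0_iff)
  ultimately show ?thesis
    unfolding H_def by (meson mult_right_le_imp_le)
qed auto

text \<open>Each vertex of large degree in \<open>W\<close> is extended by a clique list inside its
  neighbourhood, which keeps a proportion \<open>\<delta> / 2\<close> of \<open>W\<close>. The power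
  of \<open>\<delta> / 2\<close> in the hypothesis keeps the successive neighbourhoods above the
  density threshold.\<close>

lemma card_clique_lists_ge:
  assumes fin: "finite V" and dense: "dense_rel R \<delta> m V" and \<delta>: "0 < \<delta>" "\<delta> \<le> 1"
    and W: "W \<subseteq> V" "m \<le> (\<delta> / 2) ^ k * card W"
  shows "(\<delta> / 2) ^ (k * k) * card W ^ k \<le> card (clique_lists R k W)"
  using W
proof (induction k arbitrary: W)
  case 0
  have "clique_lists R 0 W = {[]}"
    by (auto simp: clique_lists_def)
  then show ?case
    by simp
next
  case (Suc k)
  define \<eta> where "\<eta> = \<delta> / 2"
  have \<eta>: "0 < \<eta>" "\<eta> \<le> 1"
    using \<delta> by (auto simp: \<eta>_def)
  define N where "N v = {w \<in> W. R v w}" for v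
  define H where "H = {v \<in> W. \<eta> * card W \<le> card (N v)}"
  have fin_W: "finite W"
    using Suc.prems(1) fin finite_subset by blast
  have "\<eta> ^ Suc k \<le> 1"
    using \<eta> by (intro power_le_one) auto
  then have "\<eta> ^ Suc k * card W \<le> 1 * real (card W)"
    by (intro mult_right_mono) auto
  then have "m \<le> card W"
    using Suc.prems(2) unfolding \<eta>_def by linarith
  then have "\<delta> * (card W)\<^sup>2 \<le> card {(u, v). u \<in> W \<and> v \<in> W \<and> R u v}"
    using dense Suc.prems(1) unfolding dense_rel_def by blast
  then have card_H: "\<eta> * card W \<le> card H"
    using many_vertices_of_large_degree[of W \<delta> R] fin_W \<delta> by (simp add: \<eta>_def H_def N_def)
  have step: "\<eta> ^ (k * k) * (\<eta> * card W) ^ k \<le> card (clique_lists R k (N v))" if "v \<in> H" for v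
  proof -
    have N: "\<eta> * card W \<le> card (N v)"
      using that by (simp add: H_def)
    have "m \<le> \<eta> ^ k * (\<eta> * card W)"
      using Suc.prems(2) by (simp add: \<eta>_def mult_ac)
    also have "\<dots> \<le> \<eta> ^ k * card (N v)"
      using N \<eta> by (intro mult_left_mono) auto
    finally have "\<eta> ^ (k * k) * card (N v) ^ k \<le> card (clique_lists R k (N v))"
      using Suc.prems(1) unfolding \<eta>_def by (intro Suc.IH) (auto simp: N_def)
    moreover have "\<eta> ^ (k * k) * (\<eta> * card W) ^ k \<le> \<eta> ^ (k * k) * card (N v) ^ k"
      using N \<eta> by (auto intro!: mult_left_mono power_mono)
    ultimately show ?thesis
      by linarith
  qed
  \<comment> \<open>The induction step yields the exponent \<open>Suc (k + k * k)\<close>; it is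
    enlarged to the next square to keep a closed form.\<close>
  have "\<eta> ^ (Suc k * Suc k) \<le> \<eta> ^ (Suc (k + k * k))"
    using \<eta> by (intro power_decreasing) auto
  then have "\<eta> ^ (Suc k * Suc k) * card W ^ Suc k \<le> \<eta> ^ (Suc (k + k * k)) * card W ^ Suc k"
    by (intro mult_right_mono) auto
  also have "\<dots> = (\<eta> * card W) * (\<eta> ^ (k * k) * (\<eta> * card W) ^ k)"
    by (simp add: power_add power_mult_distrib)
  also have "\<dots> \<le> card H * (\<eta> ^ (k * k) * (\<eta> * card W) ^ k)"
    using card_H \<eta> by (intro mult_right_mono) auto
  also have "\<dots> = (\<Sum>v\<in>H. \<eta> ^ (k * k) * (\<eta> * card W) ^ k)"
    by simp
  also have "\<dots> \<le> (\<Sum>v\<in>H. real (card (clique_lists R k (N v))))"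
    by (intro sum_mono step)
  also have "\<dots> \<le> (\<Sum>v\<in>W. real (card (clique_lists R k (N v))))"
    using fin_W by (intro sum_mono2) (auto simp: H_def)
  also have "\<dots> = card (clique_lists R (Suc k) W)"
    by (simp add: card_clique_lists_Suc[OF fin_W] N_def)
  finally show ?case
    by (simp add: \<eta>_def)
qed

lemma exists_clique_list:
  assumes fin: "finite V" and dense: "dense_rel R \<delta> m V" and \<delta>: "0 < \<delta>" "\<delta> \<le> 1" and "0 < m"
    and W: "W \<subseteq> V" "m \<le> (\<delta> / 2) ^ k * card W"
  shows "\<exists>xs. length xs = k \<and> set xs \<subseteq> W \<and> sorted_wrt R xs"
proof -
  have "card W > 0"
    using W(2) \<open>0 < m\<close> by (cases "card W = 0") auto
  then have "0 < (\<delta> / 2) ^ (k * k) * card W ^ k"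
    using \<delta> by simp
  also have "\<dots> \<le> card (clique_lists R k W)"
    by (rule card_clique_lists_ge[OF fin dense \<delta> W])
  finally have "clique_lists R k W \<noteq> {}"
    by auto
  then show ?thesis
    by (auto simp: clique_lists_def)
qed

text \<open>Cliques are removed greedily as long as half of the vertices remain.\<close>

lemma exists_clique_blobs:
  assumes fin: "finite V" and dense: "dense_rel R \<delta> m V" and \<delta>: "0 < \<delta>" "\<delta> \<le> 1" and "0 < m"
    and irrefl: "\<And>v. \<not> R v v" and sym: "\<And>u v. R u v \<Longrightarrow> R v u"
    and large: "m \<le> (\<delta> / 2) ^ L * (card V / 2)"
  shows "real (k * L) \<le> card V / 2 + L \<Longrightarrow>
    \<exists>U (\<beta> :: 'a \<Rightarrow> nat). U \<subseteq> V \<and> card U = k * L \<and> \<beta> ` U \<subseteq> {..<k} \<and>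
      (\<forall>u\<in>U. \<forall>v\<in>U. u \<noteq> v \<longrightarrow> \<beta> u = \<beta> v \<longrightarrow> R u v)"
proof (induction k)
  case 0
  show ?case
    by (intro exI[of _ "{}"]) auto
next
  case (Suc k)
  then obtain U \<beta> where U: "U \<subseteq> V" "card U = k * L" "\<beta> ` U \<subseteq> {..<k}"
    and cl: "\<And>u v. u \<in> U \<Longrightarrow> v \<in> U \<Longrightarrow> u \<noteq> v \<Longrightarrow> \<beta> u = \<beta> v \<Longrightarrow> R u v"
    by auto
  have fin_U: "finite U"
    using U fin finite_subset by blast
  have "card (V - U) = card V - k * L" "k * L \<le> card V"
    using U fin by (auto simp: card_Diff_subset fin_U card_mono simp flip: U(2))
  \<comment> \<open>The summand \<open>L\<close> in the size hypothesis leaves \<open>k * L\<close>,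
    the size of the blobs found so far, at most half of \<open>card V\<close>.\<close>
  then have "card V / 2 \<le> card (V - U)"
    using Suc.prems by (simp add: of_nat_diff)
  then have "(\<delta> / 2) ^ L * (card V / 2) \<le> (\<delta> / 2) ^ L * card (V - U)"
    using \<delta> by (intro mult_left_mono) auto
  with large obtain xs where xs: "length xs = L" "set xs \<subseteq> V - U" "sorted_wrt R xs"
    using exists_clique_list[OF fin dense \<delta> \<open>0 < m\<close>, of "V - U" L] by auto
  have R_xs: "R u v" if "u \<in> set xs" "v \<in> set xs" "u \<noteq> v" for u v
    using that xs(3) sym unfolding sorted_wrt_iff_nth_less in_set_conv_nth
    by (metis linorder_neqE_nat)
  have "distinct xs"
    using xs(3) irrefl unfolding sorted_wrt_iff_nth_less distinct_conv_nth
    by (metis linorder_neqE_nat)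
  then have card_xs: "card (set xs) = L"
    using xs(1) distinct_card by blast
  define \<beta>' where "\<beta>' v = (if v \<in> U then \<beta> v else k)" for v
  show ?case
  proof (intro exI[of _ "U \<union> set xs"] exI[of _ \<beta>'] conjI ballI impI)
    show "card (U \<union> set xs) = Suc k * L"
      using xs(2) U(2) fin_U card_xs by (subst card_Un_disjoint) auto
    show "\<beta>' ` (U \<union> set xs) \<subseteq> {..<Suc k}"
      using U(3) by (force simp: \<beta>'_def)
    fix u v assume uv: "u \<in> U \<union> set xs" "v \<in> U \<union> set xs" "u \<noteq> v" "\<beta>' u = \<beta>' v"
    show "R u v"
    proof (cases "u \<in> U \<longleftrightarrow> v \<in> U")
      case True
      then show ?thesis
        using uv cl R_xs by (auto simp: \<beta>'_def)
    next
      case False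
      then show ?thesis
        using uv U(3) by (auto simp: \<beta>'_def split: if_splits)
    qed
  qed (use U(1) xs(2) in auto)
qed

section \<open>Induced bipartite graphs and the double counting upper bound\<close>

lemma finite_all_pairs: "finite (all_pairs n)"
  by (rule finite_subset[of _ "Pow {..<n}"]) (auto simp: all_pairs_def)

lemma doubleton_in_all_pairs: "{u, v} \<in> all_pairs n \<longleftrightarrow> u < n \<and> v < n \<and> u \<noteq> v"
  by (auto simp: all_pairs_def doubleton_eq_iff)

lemma all_pairsE:
  assumes "e \<in> all_pairs n"
  obtains u v where "u < n" "v < n" "u \<noteq> v" "e = {u, v}"
  using assms unfolding all_pairs_def mem_Collect_eq by (elim exE conjE) (rule that)

lemma doubleton_in_Kbip_E:
  "u < s + r \<Longrightarrow> v < s + r \<Longrightarrow> {u, v} \<in> Kbip_E s r \<longleftrightarrow> (u < s \<longleftrightarrow> \<not> v < s)"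
  by (auto simp: Kbip_E_def doubleton_eq_iff)

text \<open>The lists are the two sides in order. Vertices of one side are distinct by the list
  conditions, those of different sides because \<open>E\<close> has no loops.\<close>

lemma has_induced_copy_KbipI:
  assumes E: "E \<subseteq> all_pairs n" and len: "length xs = s" "length ys = r"
    and sub: "set xs \<subseteq> {..<n}" "set ys \<subseteq> {..<n}"
    and indep: "sorted_wrt (\<lambda>u v. u \<noteq> v \<and> {u, v} \<notin> E) xs" "sorted_wrt (\<lambda>u v. u \<noteq> v \<and> {u, v} \<notin> E) ys"
    and complete: "\<And>x y. x \<in> set xs \<Longrightarrow> y \<in> set ys \<Longrightarrow> {x, y} \<in> E"
  shows "has_induced_copy (Kbip_V s r) (Kbip_E s r) n E"
proof -
  define \<phi> where "\<phi> i = (if i < s then xs ! i else ys ! (i - s))" for i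
  have mem: "\<phi> i \<in> (if i < s then set xs else set ys)" if "i < s + r" for i
    using that len by (auto simp: \<phi>_def)
  have same_side: "\<phi> i \<noteq> \<phi> j \<and> {\<phi> i, \<phi> j} \<notin> E"
    if "i < j" "j < s + r" "i < s \<longleftrightarrow> j < s" for i j
  proof (cases "j < s")
    case True
    with that indep(1) len(1) show ?thesis
      by (simp add: sorted_wrt_iff_nth_less \<phi>_def)
  next
    case False
    with that have "i - s < j - s" "j - s < length ys" "\<not> i < s"
      using len by auto
    with False indep(2) show ?thesis
      unfolding sorted_wrt_iff_nth_less \<phi>_def by simp
  qed
  have other_side: "{\<phi> i, \<phi> j} \<in> E" if "i < s" "s \<le> j" "j < s + r" for i j
    using that mem[of i] mem[of j] complete by auto
  have edge: "({u, v} \<in> Kbip_E s r \<longleftrightarrow> {\<phi> u, \<phi> v} \<in> E) \<and> \<phi> u \<noteq> \<phi> v"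
    if "u < v" "v < s + r" for u v
  proof (cases "u < s \<longleftrightarrow> v < s")
    case True
    with that show ?thesis
      using same_side[OF that] by (auto simp: doubleton_in_Kbip_E)
  next
    case False
    then have "u < s" "s \<le> v"
      using that by auto
    with that have "{\<phi> u, \<phi> v} \<in> E"
      using other_side by blast
    moreover from this have "\<phi> u \<noteq> \<phi> v"
      using E doubleton_in_all_pairs by blast
    ultimately show ?thesis
      using that False by (simp add: doubleton_in_Kbip_E)
  qed
  show ?thesis
    unfolding has_induced_copy_def
  proof (intro exI[of _ \<phi>] conjI ballI impI)
    show "inj_on \<phi> (Kbip_V s r)"
      unfolding inj_on_def Kbip_V_def using edge by (metis lessThan_iff linorder_neqE_nat)
    show "\<phi> ` Kbip_V s r \<subseteq> {..<n}"
      using mem sub by (force simp: Kbip_V_def split: if_splits)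
    fix u v assume "u \<in> Kbip_V s r" "v \<in> Kbip_V s r" "u \<noteq> v"
    then show "{u, v} \<in> Kbip_E s r \<longleftrightarrow> {\<phi> u, \<phi> v} \<in> E"
      using edge[of u v] edge[of v u] by (cases u v rule: linorder_cases) (auto simp: Kbip_V_def insert_commute)
  qed
qed

lemma card_edges_le_sum_degrees:
  assumes "E \<subseteq> all_pairs n"
  shows "card E \<le> (\<Sum>v<n. card {w. w < n \<and> {v, w} \<in> E})"
proof -
  have "E \<subseteq> (\<lambda>(v, w). {v, w}) ` (SIGMA v:{..<n}. {w. w < n \<and> {v, w} \<in> E})"
  proof
    fix e assume "e \<in> E"
    then obtain v w where "v < n" "w < n" "e = {v, w}"
      using assms by (auto simp: all_pairs_def)
    with \<open>e \<in> E\<close> show "e \<in> (\<lambda>(v, w). {v, w}) ` (SIGMA v:{..<n}. {w. w < n \<and> {v, w} \<in> E})"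
      by (intro image_eqI[of _ _ "(v, w)"]) auto
  qed
  then have "card E \<le> card (SIGMA v:{..<n}. {w. w < n \<and> {v, w} \<in> E})"
    by (intro surj_card_le) auto
  then show ?thesis
    by simp
qed

text \<open>Pairs of a vertex and an independent \<open>s\<close>-list of \<open>\<Gamma>\<close> in
  its \<open>E\<close>-neighbourhood are counted in two ways. A list has at most \<open>M\<close>
  common neighbours, since more would contain an independent \<open>r\<close>-list and complete an
  induced copy. Vertices of degree at most \<open>D\<close> give the term \<open>n * D\<close>; a
  larger degree is controlled by the number of lists at the vertex.\<close>

lemma card_induced_Kbip_free_le:
  assumes E: "E \<subseteq> \<Gamma>" "\<Gamma> \<subseteq> all_pairs n"
    and free: "\<not> has_induced_copy (Kbip_V s r) (Kbip_E s r) n E"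
    and "0 < s" "s \<le> r"
    and dense: "dense_rel (\<lambda>u v. u \<noteq> v \<and> {u, v} \<notin> \<Gamma>) \<delta> m {..<n}"
    and \<delta>: "0 < \<delta>" "\<delta> \<le> 1" and "0 < m"
    and M: "m \<le> (\<delta> / 2) ^ r * M" and D: "M \<le> D" "0 < D"
  shows "card E \<le> n * D + real n ^ s * M / ((\<delta> / 2) ^ (s * s) * D ^ (s - 1))"
proof -
  define R where "R = (\<lambda>u v. u \<noteq> v \<and> {u, v} \<notin> \<Gamma>)"
  define \<eta> where "\<eta> = \<delta> / 2"
  have \<eta>: "0 < \<eta>" "\<eta> \<le> 1"
    using \<delta> by (auto simp: \<eta>_def)
  define N where "N v = {w. w < n \<and> {v, w} \<in> E}" for v
  define T where "T = clique_lists R s {..<n}"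
  define CN where "CN xs = {v \<in> {..<n}. \<forall>x\<in>set xs. {v, x} \<in> E}" for xs
  have fin_T: "finite T"
    by (simp add: T_def finite_clique_lists)
  have fin_N: "finite (N v)" for v
    by (simp add: N_def)
  have card_CN: "card (CN xs) \<le> M" if "xs \<in> T" for xs
  proof (rule ccontr)
    assume "\<not> ?thesis"
    then have "\<eta> ^ r * M \<le> \<eta> ^ r * card (CN xs)"
      using \<eta> by (intro mult_left_mono) auto
    with M have "m \<le> (\<delta> / 2) ^ r * card (CN xs)"
      by (simp add: \<eta>_def)
    then obtain ys where ys: "length ys = r" "set ys \<subseteq> CN xs" "sorted_wrt R ys"
      using exists_clique_list[OF _ dense \<delta> \<open>0 < m\<close>, of "CN xs" r] by (auto simp: CN_def R_def)
    have xs: "length xs = s" "set xs \<subseteq> {..<n}" "sorted_wrt R xs"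
      using that by (auto simp: T_def clique_lists_def)
    have "has_induced_copy (Kbip_V s r) (Kbip_E s r) n E"
    proof (rule has_induced_copy_KbipI)
      show "E \<subseteq> all_pairs n"
        using E by blast
      show "sorted_wrt (\<lambda>u v. u \<noteq> v \<and> {u, v} \<notin> E) xs"
        by (rule sorted_wrt_mono_rel[OF _ xs(3)]) (use E in \<open>auto simp: R_def\<close>)
      show "sorted_wrt (\<lambda>u v. u \<noteq> v \<and> {u, v} \<notin> E) ys"
        by (rule sorted_wrt_mono_rel[OF _ ys(3)]) (use E in \<open>auto simp: R_def\<close>)
      show "{x, y} \<in> E" if "x \<in> set xs" "y \<in> set ys" for x y
        using that ys(2) by (auto simp: CN_def insert_commute)
    qed (use xs ys in \<open>auto simp: CN_def\<close>)
    with free show False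
      by blast
  qed
  have "card T \<le> card {xs. set xs \<subseteq> {..<n} \<and> length xs = s}"
    by (intro card_mono finite_lists_length_eq) (auto simp: T_def clique_lists_def)
  then have card_T: "card T \<le> n ^ s"
    by (simp add: card_lists_length_eq)
  have "clique_lists R s (N v) = {xs \<in> T. \<forall>x\<in>set xs. {v, x} \<in> E}" for v
    by (auto simp: clique_lists_def T_def N_def)
  then have "(\<Sum>v<n. card (clique_lists R s (N v))) = (\<Sum>xs\<in>T. card (CN xs))"
    using sum.swap_restrict[of "{..<n}" T "\<lambda>_ _. 1::nat" "\<lambda>v xs. \<forall>x\<in>set xs. {v, x} \<in> E"] fin_T
    by (simp add: CN_def)
  then have "real (\<Sum>v<n. card (clique_lists R s (N v))) = (\<Sum>xs\<in>T. real (card (CN xs)))"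
    by simp
  also have "\<dots> \<le> card T * M"
    using sum_bounded_above[of T "\<lambda>xs. real (card (CN xs))" M] card_CN by simp
  also have "\<dots> \<le> n ^ s * M"
  proof (intro mult_right_mono)
    have "0 < \<eta> ^ r * M"
      using M \<open>0 < m\<close> by (simp add: \<eta>_def)
    then show "0 \<le> M"
      using \<eta> by (simp add: zero_less_mult_iff)
  qed (use card_T in simp)
  finally have total: "(\<Sum>v<n. real (card (clique_lists R s (N v)))) \<le> n ^ s * M"
    by simp
  have degree: "card (N v) \<le> D + card (clique_lists R s (N v)) / (\<eta> ^ (s * s) * D ^ (s - 1))"
    (is "_ \<le> D + ?t") for v
  proof (cases "card (N v) \<le> D")
    case False
    have "\<eta> ^ r * M \<le> \<eta> ^ s * card (N v)"
    proof -
      have "\<eta> ^ r * M \<le> \<eta> ^ r * card (N v)"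
        using False D \<eta> by (intro mult_left_mono) auto
      also have "\<dots> \<le> \<eta> ^ s * card (N v)"
        using \<eta> \<open>s \<le> r\<close> by (intro mult_right_mono power_decreasing) auto
      finally show ?thesis .
    qed
    then have "\<eta> ^ (s * s) * card (N v) ^ s \<le> card (clique_lists R s (N v))"
      using card_clique_lists_ge[OF _ dense \<delta>, of "N v" s] M by (auto simp: N_def \<eta>_def R_def)
    \<comment> \<open>One factor \<open>card (N v)\<close> is kept and the other
      \<open>s - 1\<close> are lowered to \<open>D\<close>, which makes the bound linear in the
      degree.\<close>
    moreover have "card (N v) * D ^ (s - 1) \<le> card (N v) * real (card (N v)) ^ (s - 1)"
      using False D by (intro mult_left_mono power_mono) auto
    then have "\<eta> ^ (s * s) * (card (N v) * D ^ (s - 1)) \<le> \<eta> ^ (s * s) * card (N v) ^ s"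
      using \<eta> power_minus_mult[OF \<open>0 < s\<close>, of "real (card (N v))"]
      by (intro mult_left_mono) (simp_all add: mult.commute)
    ultimately have "card (N v) * (\<eta> ^ (s * s) * D ^ (s - 1)) \<le> card (clique_lists R s (N v))"
      by (simp add: mult_ac)
    then have "card (N v) \<le> ?t"
      using \<eta> D by (simp add: pos_le_divide_eq)
    with D show ?thesis
      by linarith
  qed (use \<eta> D in \<open>auto intro!: add_increasing2\<close>)
  have "real (card E) \<le> (\<Sum>v<n. real (card (N v)))"
  proof -
    have "card E \<le> (\<Sum>v<n. card (N v))"
      unfolding N_def using E by (intro card_edges_le_sum_degrees) blast
    then have "real (card E) \<le> real (\<Sum>v<n. card (N v))"
      by (rule of_nat_mono)
    then show ?thesis
      by simp
  qed
  also have "\<dots> \<le> (\<Sum>v<n. D + card (clique_lists R s (N v)) / (\<eta> ^ (s * s) * D ^ (s - 1)))"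
    by (intro sum_mono degree)
  also have "\<dots> = n * D + (\<Sum>v<n. real (card (clique_lists R s (N v)))) / (\<eta> ^ (s * s) * D ^ (s - 1))"
    by (simp add: sum.distrib sum_divide_distrib)
  also have "\<dots> \<le> n * D + (n ^ s * M) / (\<eta> ^ (s * s) * D ^ (s - 1))"
    using \<eta> D by (intro add_left_mono divide_right_mono total) auto
  finally show ?thesis
    by (simp add: \<eta>_def)
qed

section \<open>Colour classes free of induced bipartite graphs\<close>

lemma card_adjacent_pairs_le:
  assumes "\<Gamma> \<subseteq> all_pairs n"
  shows "card {(u, v). u \<in> U \<and> v \<in> U \<and> u \<noteq> v \<and> {u, v} \<in> \<Gamma>} \<le> 2 * card {e \<in> \<Gamma>. e \<subseteq> U}"
proof -
  define G where "G = {e \<in> \<Gamma>. e \<subseteq> U}"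
  have fin: "finite G"
    using assms finite_all_pairs finite_subset by (fastforce simp: G_def)
  have ends: "finite {(u, v). {u, v} = e} \<and> card {(u, v). {u, v} = e} \<le> 2" if "e \<in> G" for e
  proof -
    have "e \<in> all_pairs n"
      using that assms by (auto simp: G_def)
    then obtain a b where "e = {a, b}"
      by (rule all_pairsE)
    then have *: "{(u, v). {u, v} = e} \<subseteq> {(a, b), (b, a)}"
      by (auto simp: doubleton_eq_iff)
    then have "{(u, v). {u, v} = e} \<subseteq> set [(a, b), (b, a)]"
      by simp
    then have "card {(u, v). {u, v} = e} \<le> card (set [(a, b), (b, a)])"
      by (rule card_mono[OF finite_set])
    also have "card (set [(a, b), (b, a)]) \<le> length [(a, b), (b, a)]"
      by (rule card_length)
    also have "length [(a, b), (b, a)] = 2"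
      by simp
    finally show ?thesis
      using finite_subset[OF *] by simp
  qed
  have "card {(u, v). u \<in> U \<and> v \<in> U \<and> u \<noteq> v \<and> {u, v} \<in> \<Gamma>} \<le> card (\<Union>e\<in>G. {(u, v). {u, v} = e})"
  proof (rule card_mono)
    show "finite (\<Union>e\<in>G. {(u, v). {u, v} = e})"
      using ends by (intro finite_UN_I fin) simp
  qed (auto simp: G_def)
  also have "\<dots> \<le> (\<Sum>e\<in>G. card {(u, v). {u, v} = e})"
    by (rule card_UN_le[OF fin])
  also have "\<dots> \<le> (\<Sum>e\<in>G. 2)"
    by (rule sum_mono) (simp add: ends)
  finally show ?thesis
    by (simp add: G_def)
qed

text \<open>An independent set of \<open>E\<close> meets each blob at most once, so an induced \<open>K\<^bsub>s,r\<^esub>\<close> projects to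
  \<open>s\<close> blobs with at least \<open>r - s\<close> further common neighbours in one colour class of \<open>\<kappa>\<close>. The colour
  is chosen by pigeonhole.\<close>

lemma exists_induced_Kbip_free_subgraph:
  fixes \<beta> :: "nat \<Rightarrow> nat" and \<kappa> :: "nat \<Rightarrow> nat \<Rightarrow> nat"
  assumes \<Gamma>: "\<Gamma> \<subseteq> all_pairs n" and U: "\<beta> ` U \<subseteq> {..<B}"
    and blob: "\<And>u v. u \<in> U \<Longrightarrow> v \<in> U \<Longrightarrow> u \<noteq> v \<Longrightarrow> \<beta> u = \<beta> v \<Longrightarrow> {u, v} \<in> \<Gamma>"
    and sym: "\<And>x y. \<kappa> x y = \<kappa> y x"
    and colours: "\<And>x y. x < B \<Longrightarrow> y < B \<Longrightarrow> \<kappa> x y < q"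
    and common: "\<And>S c. S \<subseteq> {..<B} \<Longrightarrow> card S = s \<Longrightarrow> card {y. y < B \<and> (\<forall>x\<in>S. \<kappa> x y = c)} \<le> t"
    and "0 < q" "0 < s" "s + t < r"
  shows "\<exists>E\<subseteq>\<Gamma>. \<not> has_induced_copy (Kbip_V s r) (Kbip_E s r) n E \<and>
    card {e \<in> \<Gamma>. e \<subseteq> U} \<le> q * card E"
proof -
  define G where "G = {e \<in> \<Gamma>. e \<subseteq> U}"
  \<comment> \<open>Edges inside blobs lie in every class. The classes cover \<open>G\<close> with
    overlaps, which the pigeonhole argument allows.\<close>
  define E where "E c = {e \<in> G. \<exists>u v. e = {u, v} \<and> (\<beta> u = \<beta> v \<or> \<kappa> (\<beta> u) (\<beta> v) = c)}" for c
  have fin: "finite G"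
    using \<Gamma> finite_all_pairs finite_subset by (fastforce simp: G_def)
  have "G \<subseteq> (\<Union>c<q. E c)"
  proof
    fix e assume e: "e \<in> G"
    then have "e \<in> all_pairs n"
      using \<Gamma> by (auto simp: G_def)
    then obtain u v where uv: "e = {u, v}"
      by (rule all_pairsE)
    then have "\<kappa> (\<beta> u) (\<beta> v) < q"
      using e U by (intro colours) (auto simp: G_def)
    moreover have "e \<in> E (\<kappa> (\<beta> u) (\<beta> v))"
      using e uv unfolding E_def by blast
    ultimately show "e \<in> (\<Union>c<q. E c)"
      by blast
  qed
  then have "card G \<le> card (\<Union>c<q. E c)"
    using fin by (intro card_mono) (auto simp: E_def)
  also have "\<dots> \<le> (\<Sum>c<q. card (E c))"
    by (intro card_UN_le) auto
  finally have G_le: "card G \<le> (\<Sum>c<q. card (E c))" .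
  have "\<exists>c<q. card G \<le> q * card (E c)"
  proof (rule ccontr)
    assume "\<not> ?thesis"
    then have "(\<Sum>c<q. q * card (E c)) < (\<Sum>c<q. card G)"
      using \<open>0 < q\<close> by (intro sum_strict_mono) (auto simp: not_le lessThan_empty_iff)
    with G_le show False
      by (simp add: sum_distrib_left[symmetric])
  qed
  then obtain c where c: "card G \<le> q * card (E c)"
    by blast
  have E_mem: "u \<in> U \<and> v \<in> U \<and> (\<beta> u = \<beta> v \<or> \<kappa> (\<beta> u) (\<beta> v) = c)" if "{u, v} \<in> E c" for u v
  proof -
    have "\<exists>u' v'. {u, v} = {u', v'} \<and> (\<beta> u' = \<beta> v' \<or> \<kappa> (\<beta> u') (\<beta> v') = c)"
      using that unfolding E_def mem_Collect_eq by (rule conjunct2)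
    then obtain u' v' where "{u, v} = {u', v'}" "\<beta> u' = \<beta> v' \<or> \<kappa> (\<beta> u') (\<beta> v') = c"
      by (elim exE conjE)
    then have "\<beta> u = \<beta> v \<or> \<kappa> (\<beta> u) (\<beta> v) = c"
      using sym[of "\<beta> u" "\<beta> v"] by (auto simp: doubleton_eq_iff)
    moreover have "{u, v} \<subseteq> U"
      using that unfolding E_def G_def by blast
    ultimately show ?thesis
      by simp
  qed
  have "\<not> has_induced_copy (Kbip_V s r) (Kbip_E s r) n (E c)"
  proof
    assume "has_induced_copy (Kbip_V s r) (Kbip_E s r) n (E c)"
    then obtain \<phi> where inj: "inj_on \<phi> {..<s + r}"
      and edge: "\<And>u v. u < s + r \<Longrightarrow> v < s + r \<Longrightarrow> u \<noteq> v \<Longrightarrow>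
        {\<phi> u, \<phi> v} \<in> E c \<longleftrightarrow> (u < s \<longleftrightarrow> \<not> v < s)"
      unfolding has_induced_copy_def Kbip_V_def by (auto simp: doubleton_in_Kbip_E)
    have across: "{\<phi> i, \<phi> j} \<in> E c" if "i < s" "s \<le> j" "j < s + r" for i j
      using edge[of i j] that by auto
    have in_U: "\<phi> i \<in> U" if "i < s + r" for i
    proof (cases "i < s")
      case True
      with across[of i s] E_mem \<open>s + t < r\<close> show ?thesis
        by auto
    next
      case False
      with across[of 0 i] E_mem that \<open>0 < s\<close> show ?thesis
        by auto
    qed
    have \<beta>_neq: "\<beta> (\<phi> i) \<noteq> \<beta> (\<phi> j)" if "i < s + r" "j < s + r" "i \<noteq> j" "i < s \<longleftrightarrow> j < s" for i j
    proof
      assume eq: "\<beta> (\<phi> i) = \<beta> (\<phi> j)"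
      have "\<phi> i \<noteq> \<phi> j"
        using inj that by (auto simp: inj_on_def)
      then have "{\<phi> i, \<phi> j} \<in> E c"
        using blob[of "\<phi> i" "\<phi> j"] eq in_U that by (auto simp: E_def G_def)
      with edge[of i j] that show False
        by auto
    qed
    define P where "P = (\<lambda>i. \<beta> (\<phi> i)) ` {..<s}"
    define Q where "Q = (\<lambda>i. \<beta> (\<phi> i)) ` {s..<s + r}"
    have "card P = card {..<s}"
      unfolding P_def by (intro card_image inj_onI) (metis \<beta>_neq lessThan_iff trans_less_add1)
    then have "card P = s" "finite P"
      by (simp_all add: P_def)
    have "card Q = card {s..<s + r}"
      unfolding Q_def by (intro card_image inj_onI) (metis \<beta>_neq atLeastLessThan_iff not_le)
    then have "card Q = r"
      by simp
    have "\<beta> (\<phi> i) < B" if "i < s + r" for i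
      using in_U[OF that] U by blast
    then have "P \<subseteq> {..<B}" "Q \<subseteq> {..<B}"
      by (auto simp: P_def Q_def)
    \<comment> \<open>A vertex of the large side may share a blob with one of the small side, and
      their edge then carries no colour. Removing \<open>P\<close> discards at most \<open>s\<close>
      such blobs.\<close>
    have "Q - P \<subseteq> {y. y < B \<and> (\<forall>x\<in>P. \<kappa> x y = c)}"
    proof
      fix y assume y: "y \<in> Q - P"
      have "\<kappa> x y = c" if x: "x \<in> P" for x
      proof -
        obtain i j where ij: "i < s" "x = \<beta> (\<phi> i)" "s \<le> j" "j < s + r" "y = \<beta> (\<phi> j)"
          using x y by (auto simp: P_def Q_def)
        then have "\<beta> (\<phi> i) = \<beta> (\<phi> j) \<or> \<kappa> (\<beta> (\<phi> i)) (\<beta> (\<phi> j)) = c"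
          using E_mem[OF across] by blast
        with ij x y show ?thesis
          by auto
      qed
      then show "y \<in> {y. y < B \<and> (\<forall>x\<in>P. \<kappa> x y = c)}"
        using y \<open>Q \<subseteq> {..<B}\<close> by auto
    qed
    then have "card (Q - P) \<le> card {y. y < B \<and> (\<forall>x\<in>P. \<kappa> x y = c)}"
      by (intro card_mono) auto
    also have "\<dots> \<le> t"
      using common[OF \<open>P \<subseteq> {..<B}\<close> \<open>card P = s\<close>] .
    finally have "card (Q - P) \<le> t" .
    moreover have "card Q - card P \<le> card (Q - P)"
      by (rule diff_card_le_card_Diff[OF \<open>finite P\<close>])
    ultimately show False
      using \<open>card P = s\<close> \<open>card Q = r\<close> \<open>s + t < r\<close> by simp
  qed
  then show ?thesis
    using c by (intro exI[of _ "E c"]) (auto simp: G_def E_def)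
qed

section \<open>Density of random graphs\<close>

text \<open>Chernoff bound for the lower tail: Markov's inequality for \<open>Y\<close>, which is
  \<open>1 / 2\<close> to the power of the number of successes and has expectation
  \<open>(1 - q / 2) ^ card B\<close>. The value \<open>b\<close> selects presence or absence of
  edges.\<close>

lemma prob_few_successes_le:
  fixes b :: bool
  assumes "finite A" "B \<subseteq> A" and p: "0 \<le> p" "p \<le> 1"
  defines "q \<equiv> pmf (bernoulli_pmf p) b"
  shows "measure_pmf.prob (Pi_pmf A False (\<lambda>_. bernoulli_pmf p))
    {f. card {e \<in> B. f e = b} < q / 4 * card B} \<le> exp (- (q / 4 * card B))"
proof -
  let ?M = "Pi_pmf A False (\<lambda>_. bernoulli_pmf p)"
  define g :: "'a \<Rightarrow> bool \<Rightarrow> real" where "g e v = (if e \<in> B \<and> v = b then 1 / 2 else 1)" for e v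
  define Y where "Y f = (\<Prod>e\<in>A. g e (f e))" for f
  have fin_B: "finite B"
    using assms finite_subset by blast
  have q: "0 \<le> q" "q \<le> 1"
    by (simp_all add: q_def pmf_le_1)
  have Y_eq: "Y f = (1 / 2) ^ card {e \<in> B. f e = b}" for f
  proof -
    have "Y f = (\<Prod>e\<in>{e \<in> B. f e = b}. 1 / 2)"
      unfolding Y_def using \<open>finite A\<close>
    proof (rule prod.mono_neutral_cong_right)
      show "{e \<in> B. f e = b} \<subseteq> A"
        using \<open>B \<subseteq> A\<close> by blast
    qed (auto simp: g_def)
    then show ?thesis
      by simp
  qed
  have q_eq: "q = (if b then p else 1 - p)"
    using p by (simp add: q_def)
  have g_exp: "measure_pmf.expectation (bernoulli_pmf p) (g e) = (if e \<in> B then 1 - q / 2 else 1)" for e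
  proof -
    have "measure_pmf.expectation (bernoulli_pmf p) (g e) = g e True * p + g e False * (1 - p)"
      using p by (rule integral_bernoulli_pmf)
    also have "\<dots> = (if e \<in> B then 1 - q / 2 else 1)"
      unfolding q_eq g_def by (cases b; cases "e \<in> B"; simp; linarith?)
    finally show ?thesis .
  qed
  have "measure_pmf.expectation ?M Y = (\<Prod>e\<in>A. measure_pmf.expectation (bernoulli_pmf p) (g e))"
    unfolding Y_def using assms
    by (intro expectation_prod_Pi_pmf) (auto simp: g_def intro!: integrable_measure_pmf_finite)
  also have "\<dots> = (1 - q / 2) ^ card B"
    unfolding g_exp using assms by (simp add: prod.If_cases Int_absorb1)
  also have "\<dots> \<le> exp (- (q / 2)) ^ card B"
    using q exp_ge_add_one_self[of "- (q / 2)"] by (intro power_mono) auto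
  also have "\<dots> = exp (- (q / 2 * card B))"
    by (simp add: exp_of_nat_mult[symmetric] mult_ac)
  finally have Y_exp: "measure_pmf.expectation ?M Y \<le> exp (- (q / 2 * card B))" .
  define c where "c = exp (- (q / 4 * card B))"
  have "{f. card {e \<in> B. f e = b} < q / 4 * card B} \<subseteq> {f \<in> space (measure_pmf ?M). c \<le> Y f}"
  proof safe
    fix f assume "card {e \<in> B. f e = b} < q / 4 * card B"
    then have "c \<le> exp (- real (card {e \<in> B. f e = b}))"
      by (simp add: c_def)
    also have "\<dots> = exp (- 1) ^ card {e \<in> B. f e = b}"
      by (simp add: exp_of_nat_mult[symmetric])
    \<comment> \<open>This uses \<open>2 \<le> exp 1\<close>.\<close>
    also have "\<dots> \<le> (1 / 2) ^ card {e \<in> B. f e = b}"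
      using exp_ge_add_one_self[of 1] by (intro power_mono) (auto simp: exp_minus field_simps)
    finally show "c \<le> Y f"
      by (simp add: Y_eq)
  qed simp
  then have "measure_pmf.prob ?M {f. card {e \<in> B. f e = b} < q / 4 * card B}
      \<le> measure_pmf.prob ?M {f \<in> space (measure_pmf ?M). c \<le> Y f}"
    by (intro measure_pmf.finite_measure_mono) auto
  also have "\<dots> \<le> measure_pmf.expectation ?M Y / c"
  proof (rule integral_Markov_inequality_measure[where A = "{}"])
    show "integrable (measure_pmf ?M) Y"
      by (intro measure_pmf.integrable_const_bound[where B = 1])
        (auto simp: Y_eq intro!: power_le_one)
  qed (auto simp: Y_eq c_def)
  also have "\<dots> \<le> exp (- (q / 2 * card B)) / c"
    using Y_exp by (intro divide_right_mono) (auto simp: c_def)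
  also have "\<dots> = exp (- (q / 4 * card B))"
    by (simp add: c_def exp_diff[symmetric])
  finally show ?thesis .
qed

text \<open>The binomial theorem, in the form that sums the union bound over all vertex
  sets.\<close>

lemma sum_Pow_power_card:
  fixes y :: "'b::comm_semiring_1"
  assumes "finite A"
  shows "(\<Sum>W\<in>Pow A. y ^ card W) = (y + 1) ^ card A"
  using prod_add[OF assms, of "\<lambda>_. y" "\<lambda>_. 1"] by simp

lemma card_all_pairs_within:
  assumes "W \<subseteq> {..<n}"
  shows "card {e \<in> all_pairs n. e \<subseteq> W} = card W choose 2"
proof -
  have "{e \<in> all_pairs n. e \<subseteq> W} = {e. e \<subseteq> W \<and> card e = 2}"
    using assms by (auto simp: all_pairs_def card_2_iff)
  then show ?thesis
    using assms finite_subset[OF assms] by (simp add: n_subsets)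
qed

text \<open>A set \<open>W\<close> above the threshold fails with probability at most
  \<open>(1 / n\<^sup>2) ^ card W\<close>, small enough to sum over all nonempty \<open>W\<close>.
  The subtracted 1 is the term of the empty set.\<close>

lemma prob_gnp_not_dense_le:
  fixes n :: nat
  assumes p: "0 \<le> p" "p \<le> 1" and q: "0 < q" "q \<le> pmf (bernoulli_pmf p) b" and "2 \<le> n"
  shows "measure_pmf.prob (gnp n p)
     {\<Gamma>. \<not> dense_rel (\<lambda>u v. u \<noteq> v \<and> ({u, v} \<in> \<Gamma>) = b) (q / 16) (32 / q * ln n) {..<n}}
    \<le> (1 / n\<^sup>2 + 1) ^ n - 1"
proof -
  let ?M = "Pi_pmf (all_pairs n) False (\<lambda>_. bernoulli_pmf p)"
  define q' where "q' = pmf (bernoulli_pmf p) b"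
  define m where "m = 32 / q * ln n"
  define B where "B W = {e \<in> all_pairs n. e \<subseteq> W}" for W
  define bad where "bad W = {f. card {e \<in> B W. f e = b} < q' / 4 * card (B W)}" for W
  define I where "I = {W. W \<subseteq> {..<n} \<and> m \<le> card W}"
  have fin_I: "finite I"
    by (rule finite_subset[of _ "Pow {..<n}"]) (auto simp: I_def)
  have "q \<le> 1"
    using q pmf_le_1[of "bernoulli_pmf p" b] by linarith
  have "1 / 2 \<le> ln (2::real)"
    using ln_le_minus_one[of "1 / 2 :: real"] by (simp add: ln_div)
  then have ln_n: "1 / 2 \<le> ln n"
  proof -
    have "ln 2 \<le> ln (real n)"
      using \<open>2 \<le> n\<close> by simp
    with \<open>1 / 2 \<le> ln (2::real)\<close> show ?thesis
      by linarith
  qed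
  have "32 \<le> 32 / q"
    using q \<open>q \<le> 1\<close> by (simp add: pos_le_divide_eq)
  then have "32 * (1 / 2) \<le> 32 / q * ln n"
    using ln_n q by (intro mult_mono) auto
  then have m: "2 \<le> m"
    by (simp add: m_def)
  \<comment> \<open>The binomial coefficient is at least a quarter of the square once
    \<open>card W\<close> is at least 2. With the 4 of the tail bound this yields the 16 in the
    density.\<close>
  have card_B: "real (card (B W)) \<ge> (card W)\<^sup>2 / 4" if "W \<in> I" for W
  proof -
    have "real (card (B W)) = card W * (real (card W) - 1) / 2"
      using that m by (simp add: I_def B_def card_all_pairs_within choose_two real_of_nat_div of_nat_diff)
    moreover have "card W * (card W / 2) \<le> card W * (real (card W) - 1)"
      using that m by (intro mult_left_mono) (auto simp: I_def)
    ultimately show ?thesis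
      by (simp add: power2_eq_square)
  qed
  have prob_bad: "measure_pmf.prob ?M (bad W) \<le> (1 / n\<^sup>2) ^ card W" if "W \<in> I" for W
  proof -
    have "q' / 4 * ((card W)\<^sup>2 / 4) \<le> q' / 4 * card (B W)"
      using card_B[OF that] by (intro mult_left_mono) (auto simp: q'_def)
    \<comment> \<open>The constant 32 in the threshold is made for this bound: 16 for the density
      times the 2 in \<open>2 * ln n\<close>.\<close>
    moreover have "card W * (2 * ln n) \<le> q' / 4 * ((card W)\<^sup>2 / 4)"
    proof -
      have "32 * ln n = q * m"
        using q by (simp add: m_def)
      also have "\<dots> \<le> q' * card W"
        using that q m by (intro mult_mono) (auto simp: I_def q'_def)
      finally have "card W * (32 * ln n) \<le> card W * (q' * card W)"
        by (intro mult_left_mono) auto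
      then show ?thesis
        by (simp add: power2_eq_square mult_ac)
    qed
    ultimately have "exp (- (q' / 4 * card (B W))) \<le> exp (card W * - (2 * ln n))"
      by simp
    also have "\<dots> = exp (- (2 * ln n)) ^ card W"
      by (rule exp_of_nat_mult)
    also have "exp (- (2 * ln n)) = 1 / n\<^sup>2"
      using \<open>2 \<le> n\<close> by (simp add: exp_minus exp_double divide_inverse)
    finally show ?thesis
      using prob_few_successes_le[of "all_pairs n" "B W" p b] finite_all_pairs p
      by (auto simp: bad_def q'_def B_def)
  qed
  have "{f. \<not> dense_rel (\<lambda>u v. u \<noteq> v \<and> ({u, v} \<in> {e \<in> all_pairs n. f e}) = b) (q / 16) m {..<n}}
      \<subseteq> (\<Union>W\<in>I. bad W)"
  proof
    fix f
    let ?R = "\<lambda>u v. u \<noteq> v \<and> ({u, v} \<in> {e \<in> all_pairs n. f e}) = b"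
    assume "f \<in> {f. \<not> dense_rel (\<lambda>u v. u \<noteq> v \<and> ({u, v} \<in> {e \<in> all_pairs n. f e}) = b) (q / 16) m {..<n}}"
    then obtain W where W: "W \<in> I"
      and few: "card {(u, v). u \<in> W \<and> v \<in> W \<and> ?R u v} < q / 16 * (card W)\<^sup>2"
      by (auto simp: dense_rel_def I_def not_le)
    have W_sub: "W \<subseteq> {..<n}"
      using W by (simp add: I_def)
    have "{e \<in> B W. f e = b} \<subseteq> (\<lambda>(u, v). {u, v}) ` {(u, v). u \<in> W \<and> v \<in> W \<and> ?R u v}"
    proof
      fix e assume e: "e \<in> {e \<in> B W. f e = b}"
      then obtain u v where uv: "u < n" "v < n" "u \<noteq> v" "e = {u, v}"
        unfolding B_def by (blast elim: all_pairsE)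
      then show "e \<in> (\<lambda>(u, v). {u, v}) ` {(u, v). u \<in> W \<and> v \<in> W \<and> ?R u v}"
        using e by (intro image_eqI[of _ _ "(u, v)"]) (auto simp: B_def)
    qed
    moreover have "finite W"
      by (rule finite_subset[OF W_sub]) simp
    then have "finite (W \<times> W)"
      by simp
    then have "finite {(u, v). u \<in> W \<and> v \<in> W \<and> ?R u v}"
      by (rule rev_finite_subset) blast
    ultimately have "card {e \<in> B W. f e = b} \<le> card {(u, v). u \<in> W \<and> v \<in> W \<and> ?R u v}"
      by (rule surj_card_le[rotated])
    then have "card {e \<in> B W. f e = b} < q / 16 * (card W)\<^sup>2"
      using few by linarith
    also have "q / 16 * (card W)\<^sup>2 \<le> q' / 16 * (card W)\<^sup>2"
      using q(2) by (intro mult_right_mono) (simp_all add: q'_def)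
    also have "\<dots> = q' / 4 * ((card W)\<^sup>2 / 4)"
      by simp
    also have "\<dots> \<le> q' / 4 * card (B W)"
      using card_B[OF W] by (intro mult_left_mono) (auto simp: q'_def)
    finally show "f \<in> (\<Union>W\<in>I. bad W)"
      using W by (auto simp: bad_def)
  qed
  then have "measure_pmf.prob (gnp n p)
      {\<Gamma>. \<not> dense_rel (\<lambda>u v. u \<noteq> v \<and> ({u, v} \<in> \<Gamma>) = b) (q / 16) m {..<n}}
    \<le> measure_pmf.prob ?M (\<Union>W\<in>I. bad W)"
    unfolding gnp_def measure_map_pmf vimage_Collect_eq
    by (intro measure_pmf.finite_measure_mono) auto
  also have "\<dots> \<le> (\<Sum>W\<in>I. measure_pmf.prob ?M (bad W))"
    by (intro measure_pmf.finite_measure_subadditive_finite fin_I) auto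
  also have "\<dots> \<le> (\<Sum>W\<in>I. (1 / n\<^sup>2) ^ card W)"
    by (intro sum_mono prob_bad)
  also have "\<dots> \<le> (\<Sum>W\<in>Pow {..<n} - {{}}. (1 / n\<^sup>2) ^ card W)"
    using m by (intro sum_mono2) (auto simp: I_def)
  also have "\<dots> = (\<Sum>W\<in>Pow {..<n}. (1 / n\<^sup>2) ^ card W) - 1"
    by (subst sum_diff) auto
  also have "\<dots> = (1 / n\<^sup>2 + 1) ^ n - 1"
    by (subst sum_Pow_power_card) auto
  finally show ?thesis
    by (simp add: m_def)
qed

text \<open>The power is at most \<open>exp (1 / real n)\<close> for positive
  \<open>n\<close>.\<close>

lemma union_bound_tendsto_0: "(\<lambda>n::nat. (1 / (real n)\<^sup>2 + 1) ^ n - 1) \<longlonglongrightarrow> 0"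
proof (rule tendsto_sandwich[where f = "\<lambda>_. 0" and h = "\<lambda>n. exp (1 / real n) - 1"])
  show "\<forall>\<^sub>F n in sequentially. (1 / (real n)\<^sup>2 + 1) ^ n - 1 \<le> exp (1 / real n) - 1"
    using eventually_gt_at_top[of 0]
  proof eventually_elim
    case (elim n)
    have "(1 / (real n)\<^sup>2 + 1) ^ n \<le> exp (1 / (real n)\<^sup>2) ^ n"
      using exp_ge_add_one_self[of "1 / (real n)\<^sup>2"] by (intro power_mono) (auto simp: add.commute)
    also have "\<dots> = exp (1 / real n)"
      using elim by (simp add: exp_of_nat_mult[symmetric] power2_eq_square)
    finally show ?case
      by simp
  qed
  have "(\<lambda>n. exp (1 / real n) - 1) \<longlonglongrightarrow> exp 0 - 1"
    by (intro tendsto_intros lim_1_over_n)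
  then show "(\<lambda>n. exp (1 / real n) - 1) \<longlonglongrightarrow> 0"
    by simp
qed (auto simp: one_le_power)

section \<open>The extremal number\<close>

text \<open>The norm colouring has a power of two as its number of colours; rounding up to one costs
  a factor 2, absorbed by the constants.\<close>

lemma exists_power_of_two_between:
  fixes y :: real
  assumes "1 < y"
  shows "\<exists>k>0. y \<le> 2 ^ k \<and> 2 ^ k \<le> 2 * y"
proof -
  define k where "k = nat \<lceil>log 2 y\<rceil>"
  have pos: "0 < log 2 y"
    using assms by simp
  then have k: "log 2 y \<le> k" "k \<le> log 2 y + 1" "0 < k"
    unfolding k_def by linarith+
  have y_eq: "2 powr (log 2 y) = y"
    using assms by simp
  have "2 powr (log 2 y) \<le> 2 powr (real k)" "2 powr (real k) \<le> 2 powr (log 2 y + 1)"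
    using k by (intro powr_mono; simp)+
  then have "y \<le> 2 ^ k" "2 ^ k \<le> 2 * y"
    using y_eq by (simp_all add: powr_realpow powr_add)
  with k show ?thesis
    by blast
qed

text \<open>Blobs of size \<open>L\<close> cover half of the vertices, and their pairs receive about
  \<open>(n / L) powr (1 / s)\<close> colours. The best class keeps at least one part in that many
  of the edges inside \<open>U\<close>, of which density gives quadratically many. The bound on
  \<open>r\<close> comes from the common neighbourhoods in the norm colouring.\<close>

lemma exists_large_induced_Kbip_free_subgraph:
  assumes \<Gamma>: "\<Gamma> \<subseteq> all_pairs n"
    and dense: "dense_rel (\<lambda>u v. u \<noteq> v \<and> {u, v} \<in> \<Gamma>) \<delta> m {..<n}"
    and \<delta>: "0 < \<delta>" "\<delta> \<le> 1" and "0 < m"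
    and s: "0 < s" "s + (s + s * (2 * s + 1)) ^ s < r"
    and L: "0 < L" "2 * L \<le> n" "m \<le> (\<delta> / 2) ^ L * (n / 2)"
  shows "\<exists>E\<subseteq>\<Gamma>. \<not> has_induced_copy (Kbip_V s r) (Kbip_E s r) n E \<and>
    \<delta> * (real n)\<^sup>2 / (16 * (n / L) powr (1 / s)) \<le> card E"
proof -
  define y where "y = (n / L) powr (1 / s)"
  have "2 \<le> real n / L"
    using L by (simp add: pos_le_divide_eq flip: of_nat_mult)
  then have "1 < y"
    unfolding y_def using s by simp
  then obtain k where k: "0 < k" "y \<le> 2 ^ k" "2 ^ k \<le> 2 * y"
    using exists_power_of_two_between by blast
  \<comment> \<open>The number of blobs is rounded up so that they cover at least half of the
    vertices, with an excess of at most one blob.\<close>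
  define B where "B = nat \<lceil>n / (2 * L)\<rceil>"
  have "0 \<le> real n / (2 * L)"
    by simp
  then have B: "n / (2 * L) \<le> B" "B \<le> n / (2 * L) + 1"
    unfolding B_def by linarith+
  have "n / 2 = n / (2 * L) * L"
    using L by simp
  also have "\<dots> \<le> real B * L"
    using B by (intro mult_right_mono) auto
  finally have BL: "n / 2 \<le> real B * L" .
  have "real B * L \<le> (n / (2 * L) + 1) * L"
    using B by (intro mult_right_mono) auto
  also have "\<dots> = n / 2 + L"
    using L by (simp add: distrib_right)
  finally have "real (B * L) \<le> card {..<n} / 2 + L"
    by simp
  from exists_clique_blobs[OF _ dense \<delta> \<open>0 < m\<close> _ _ _ this] L obtain U and \<beta> :: "nat \<Rightarrow> nat"
    where U: "U \<subseteq> {..<n}" "card U = B * L" "\<beta> ` U \<subseteq> {..<B}"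
      and blob: "\<forall>u\<in>U. \<forall>v\<in>U. u \<noteq> v \<longrightarrow> \<beta> u = \<beta> v \<longrightarrow> u \<noteq> v \<and> {u, v} \<in> \<Gamma>"
    by (auto simp: insert_commute)
  \<comment> \<open>The blobs become vertices of the norm colouring, so their number must not exceed
    \<open>(2 ^ k) ^ s\<close>. Here 1 is at most \<open>n / (2 * L)\<close>.\<close>
  have "B \<le> n / (2 * L) + n / (2 * L)"
    using B \<open>2 \<le> real n / L\<close> by (simp add: field_simps)
  also have "\<dots> = n / L"
    by simp
  also have "\<dots> = (n / L) powr (1 / s * s)"
    using s \<open>2 \<le> real n / L\<close> by simp
  also have "\<dots> = y powr s"
    by (simp only: y_def powr_powr)
  also have "\<dots> = y ^ s"
    using \<open>1 < y\<close> by (simp add: powr_realpow)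
  also have "\<dots> \<le> (2 ^ k) ^ s"
    using k \<open>1 < y\<close> by (intro power_mono) auto
  finally have "real B \<le> real ((2 ^ k) ^ s)"
    by simp
  then have B_le: "B \<le> (2 ^ k) ^ s"
    by (simp only: of_nat_le_iff)
  obtain \<kappa> :: "nat \<Rightarrow> nat \<Rightarrow> nat" where sym: "\<forall>x y. \<kappa> x y = \<kappa> y x"
    and colours: "\<forall>x<(2 ^ k) ^ s. \<forall>y<(2 ^ k) ^ s. \<kappa> x y < 2 ^ k"
    and common: "\<forall>S c. S \<subseteq> {..<(2 ^ k) ^ s} \<longrightarrow> card S = s \<longrightarrow>
      card {y. y < (2 ^ k) ^ s \<and> (\<forall>x\<in>S. \<kappa> x y = c)} \<le> (s + s * (2 * s + 1)) ^ s"
    using norm_colouring[OF s(1) k(1)] by blast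
  have "\<exists>E\<subseteq>\<Gamma>. \<not> has_induced_copy (Kbip_V s r) (Kbip_E s r) n E \<and>
    card {e \<in> \<Gamma>. e \<subseteq> U} \<le> 2 ^ k * card E"
  proof (rule exists_induced_Kbip_free_subgraph[OF \<Gamma> U(3), of \<kappa> "2 ^ k" s])
    show "\<kappa> x y < 2 ^ k" if "x < B" "y < B" for x y
      using colours that B_le by (meson order_less_le_trans)
    fix S c assume S: "S \<subseteq> {..<B}" "card S = s"
    have S_sub: "S \<subseteq> {..<(2 ^ k) ^ s}"
      using S(1) B_le by (meson lessThan_subset_iff order_trans)
    have "card {y. y < B \<and> (\<forall>x\<in>S. \<kappa> x y = c)}
        \<le> card {y. y < (2 ^ k) ^ s \<and> (\<forall>x\<in>S. \<kappa> x y = c)}"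
      using B_le by (intro card_mono) auto
    also have "\<dots> \<le> (s + s * (2 * s + 1)) ^ s"
      using common S_sub S(2) by blast
    finally show "card {y. y < B \<and> (\<forall>x\<in>S. \<kappa> x y = c)} \<le> (s + s * (2 * s + 1)) ^ s" .
  qed (use blob sym s in auto)
  then obtain E where E: "E \<subseteq> \<Gamma>" "\<not> has_induced_copy (Kbip_V s r) (Kbip_E s r) n E"
    "card {e \<in> \<Gamma>. e \<subseteq> U} \<le> 2 ^ k * card E"
    by blast
  have card_U: "n / 2 \<le> card U"
    using BL U by simp
  have "(\<delta> / 2) ^ L \<le> 1"
    using \<delta> by (intro power_le_one) auto
  then have "(\<delta> / 2) ^ L * (n / 2) \<le> 1 * (n / 2)"
    by (intro mult_right_mono) auto
  then have "m \<le> card U"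
    using L card_U by linarith
  then have "\<delta> * (card U)\<^sup>2 \<le> card {(u, v). u \<in> U \<and> v \<in> U \<and> u \<noteq> v \<and> {u, v} \<in> \<Gamma>}"
    using dense U(1) unfolding dense_rel_def by blast
  also have "\<dots> \<le> real (2 * card {e \<in> \<Gamma>. e \<subseteq> U})"
    using card_adjacent_pairs_le[OF \<Gamma>, of U] by (simp only: of_nat_le_iff)
  also have "\<dots> \<le> real (2 * (2 ^ k * card E))"
    using E(3) by (simp only: of_nat_le_iff mult_le_mono2)
  also have "\<dots> = 2 * 2 ^ k * real (card E)"
    by simp
  also have "\<dots> \<le> 2 * (2 * y) * card E"
    using k by (intro mult_right_mono mult_left_mono) auto
  finally have "\<delta> * (card U)\<^sup>2 \<le> 4 * y * card E"
    by simp
  moreover have "\<delta> * (n / 2)\<^sup>2 \<le> \<delta> * (card U)\<^sup>2"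
    using card_U \<delta> by (intro mult_left_mono power_mono) auto
  ultimately have "\<delta> * (n / 2)\<^sup>2 \<le> 4 * y * card E"
    by linarith
  then have "\<delta> * (real n)\<^sup>2 / (16 * y) \<le> card E"
    using \<open>1 < y\<close> by (simp add: pos_divide_le_eq power_divide mult_ac)
  with E show ?thesis
    unfolding y_def by blast
qed

section \<open>Extremal numbers with explicit parameters\<close>

lemma ex_induced_geI:
  assumes "finite \<Gamma>" "E \<subseteq> \<Gamma>" "\<not> has_induced_copy VH EH n E"
  shows "card E \<le> ex_induced VH EH n \<Gamma>"
  unfolding ex_induced_def
proof (rule Max_ge)
  show "finite {card E |E. E \<subseteq> \<Gamma> \<and> \<not> has_induced_copy VH EH n E}"
    by (rule finite_subset[of _ "card ` Pow \<Gamma>"]) (use \<open>finite \<Gamma>\<close> in auto)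
qed (use assms in auto)

text \<open>The witness \<open>E0\<close> makes the set of sizes nonempty, so that its maximum is
  attained by some \<open>E\<close>.\<close>

lemma ex_induced_leI:
  fixes b :: real
  assumes "finite \<Gamma>" "E0 \<subseteq> \<Gamma>" "\<not> has_induced_copy VH EH n E0"
    and "\<And>E. E \<subseteq> \<Gamma> \<Longrightarrow> \<not> has_induced_copy VH EH n E \<Longrightarrow> card E \<le> b"
  shows "ex_induced VH EH n \<Gamma> \<le> b"
proof -
  have "ex_induced VH EH n \<Gamma> \<in> {card E |E. E \<subseteq> \<Gamma> \<and> \<not> has_induced_copy VH EH n E}"
    unfolding ex_induced_def
  proof (rule Max_in)
    show "finite {card E |E. E \<subseteq> \<Gamma> \<and> \<not> has_induced_copy VH EH n E}"
      by (rule finite_subset[of _ "card ` Pow \<Gamma>"]) (use \<open>finite \<Gamma>\<close> in auto)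
  qed (use assms in auto)
  with assms(4) show ?thesis
    by auto
qed

text \<open>The degree threshold \<open>D\<close> balances the two terms of the counting bound:
  since \<open>D ^ s = real n ^ (s - 1) * ln n\<close>, the second term is a constant multiple of
  \<open>n * D\<close>.\<close>

lemma ex_induced_Kbip_upper:
  fixes n s r :: nat
  assumes \<Gamma>: "\<Gamma> \<subseteq> all_pairs n" and s: "0 < s" "s \<le> r"
    and dense: "dense_rel (\<lambda>u v. u \<noteq> v \<and> {u, v} \<notin> \<Gamma>) \<delta> (c0 * ln n) {..<n}"
    and \<delta>: "0 < \<delta>" "\<delta> \<le> 1" and "0 < c0" and n: "1 < n"
    and large: "c0 / (\<delta> / 2) ^ r * ln n \<le> n powr (1 - 1 / s) * ln n powr (1 / s)"
  shows "ex_induced (Kbip_V s r) (Kbip_E s r) n \<Gamma> \<le>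
    (1 + c0 / (\<delta> / 2) ^ r / (\<delta> / 2) ^ (s * s)) * (n powr (2 - 1 / s) * ln n powr (1 / s))"
proof -
  define \<eta> where "\<eta> = \<delta> / 2"
  have \<eta>: "0 < \<eta>"
    using \<delta> by (simp add: \<eta>_def)
  define D where "D = n powr (1 - 1 / s) * ln n powr (1 / s)"
  have ln_pos: "0 < ln (real n)"
    using n by simp
  then have "0 < D"
    using n by (simp add: D_def)
  have "D ^ s = n powr ((1 - 1 / s) * s) * ln n powr (1 / s * s)"
    using ln_pos n by (simp add: D_def power_mult_distrib powr_realpow[symmetric] powr_powr)
  also have "(1 - 1 / s) * s = real (s - 1)"
    using s by (simp add: field_simps of_nat_diff)
  also have "real n powr real (s - 1) = real n ^ (s - 1)"
    using n by (intro powr_realpow) simp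
  also have "ln (real n) powr (1 / s * s) = ln n"
    using s ln_pos by simp
  finally have D_power: "D ^ s = real n ^ (s - 1) * ln n" .
  have "n powr (2 - 1 / s) = n powr (1 + (1 - 1 / s))"
    by simp
  also have "\<dots> = n * n powr (1 - 1 / s)"
    using n by (simp only: powr_add) simp
  finally have nD: "n * D = n powr (2 - 1 / s) * ln n powr (1 / s)"
    by (simp add: D_def)
  have "real n ^ s * ln n = n * D ^ s"
    using power_minus_mult[OF s(1), of "real n"] by (simp add: D_power mult_ac)
  also have "\<dots> = n * D * D ^ (s - 1)"
    using power_minus_mult[OF s(1), of D] by (simp add: mult_ac)
  finally have n_ln: "real n ^ s * ln n = n * D * D ^ (s - 1)" .
  show ?thesis
  proof (rule ex_induced_leI)
    show "finite \<Gamma>"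
      by (rule finite_subset[OF \<Gamma> finite_all_pairs])
    \<comment> \<open>The empty graph is the witness, as the bipartite graph has the edge
      \<open>{0, s}\<close>.\<close>
    show "\<not> has_induced_copy (Kbip_V s r) (Kbip_E s r) n {}"
    proof
      assume "has_induced_copy (Kbip_V s r) (Kbip_E s r) n {}"
      then have "\<forall>u\<in>Kbip_V s r. \<forall>v\<in>Kbip_V s r. u \<noteq> v \<longrightarrow> {u, v} \<notin> Kbip_E s r"
        by (auto simp: has_induced_copy_def)
      then have "{0, s} \<notin> Kbip_E s r"
        using s by (auto simp: Kbip_V_def)
      with s show False
        by (simp add: doubleton_in_Kbip_E)
    qed
    fix E assume E: "E \<subseteq> \<Gamma>" "\<not> has_induced_copy (Kbip_V s r) (Kbip_E s r) n E"
    have "card E \<le> n * D + real n ^ s * (c0 / \<eta> ^ r * ln n) / (\<eta> ^ (s * s) * D ^ (s - 1))"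
      unfolding \<eta>_def
    proof (rule card_induced_Kbip_free_le[OF E(1) \<Gamma> E(2) s dense \<delta> _ _ _ \<open>0 < D\<close>])
      show "c0 / (\<delta> / 2) ^ r * ln n \<le> D"
        using large by (simp add: D_def)
    qed (use \<open>0 < c0\<close> ln_pos \<delta> in auto)
    also have "real n ^ s * (c0 / \<eta> ^ r * ln n) / (\<eta> ^ (s * s) * D ^ (s - 1))
        = c0 / \<eta> ^ r / \<eta> ^ (s * s) * (real n ^ s * ln n / D ^ (s - 1))"
      by (simp add: mult_ac)
    also have "real n ^ s * ln n / D ^ (s - 1) = n * D"
      using \<open>0 < D\<close> by (simp add: n_ln)
    also have "n * D + c0 / \<eta> ^ r / \<eta> ^ (s * s) * (n * D) = (1 + c0 / \<eta> ^ r / \<eta> ^ (s * s)) * (n * D)"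
      by (simp only: distrib_right mult_1_left)
    finally show "card E \<le>
        (1 + c0 / (\<delta> / 2) ^ r / (\<delta> / 2) ^ (s * s)) * (n powr (2 - 1 / s) * ln n powr (1 / s))"
      by (simp only: nD \<eta>_def)
  qed auto
qed

text \<open>Blobs have size about \<open>c1 * ln n\<close>. The condition on \<open>c1\<close> makes
  \<open>\<delta> / 2\<close> to the power \<open>c1 * ln n\<close> equal to
  \<open>n powr (- (1 / 2))\<close>, so the clique search keeps neighbourhoods of order at least the
  square root of \<open>n\<close>, above the logarithmic threshold.\<close>

lemma ex_induced_Kbip_lower:
  fixes n s r :: nat
  assumes \<Gamma>: "\<Gamma> \<subseteq> all_pairs n"
    and s: "0 < s" "s + (s + s * (2 * s + 1)) ^ s < r"
    and dense: "dense_rel (\<lambda>u v. u \<noteq> v \<and> {u, v} \<in> \<Gamma>) \<delta> (c0 * ln n) {..<n}"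
    and \<delta>: "0 < \<delta>" "\<delta> \<le> 1" and "0 < c0" and n: "1 < n"
    and c1: "0 < c1" "c1 * ln (2 / \<delta>) = 1 / 2"
    and large: "2 \<le> c1 * ln n" "2 * (c1 * ln n) \<le> n" "c0 * ln n \<le> n powr (- (1 / 2)) * (n / 2)"
  shows "\<delta> / 16 * (c1 / 2) powr (1 / s) * (n powr (2 - 1 / s) * ln n powr (1 / s))
    \<le> ex_induced (Kbip_V s r) (Kbip_E s r) n \<Gamma>"
proof -
  define L where "L = nat \<lfloor>c1 * ln n\<rfloor>"
  have L: "L \<le> c1 * ln n" "c1 * ln n / 2 \<le> L" "0 < L"
    using large(1) unfolding L_def by linarith+
  have ln_pos: "0 < ln (real n)"
    using n by simp
  have "\<exists>E\<subseteq>\<Gamma>. \<not> has_induced_copy (Kbip_V s r) (Kbip_E s r) n E \<and>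
    \<delta> * (real n)\<^sup>2 / (16 * (n / L) powr (1 / s)) \<le> card E"
  proof (rule exists_large_induced_Kbip_free_subgraph[OF \<Gamma> dense \<delta> _ s L(3)])
    show "2 * L \<le> n"
      using L(1) large(2) by linarith
    have "n powr (- (1 / 2)) = exp (- ln (2 / \<delta>) * (c1 * ln n))"
      using c1(2) n by (simp add: powr_def algebra_simps)
    also have "\<dots> \<le> exp (- ln (2 / \<delta>) * L)"
      using L(1) \<delta> by (simp add: mult_left_mono)
    also have "\<dots> = exp (- ln (2 / \<delta>)) ^ L"
      by (simp only: mult.commute[of _ "real L"] exp_of_nat_mult)
    also have "exp (- ln (2 / \<delta>)) = \<delta> / 2"
      using \<delta> by (simp add: exp_minus)
    finally have "n powr (- (1 / 2)) * (n / 2) \<le> (\<delta> / 2) ^ L * (n / 2)"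
      by (intro mult_right_mono) auto
    with large(3) show "c0 * ln n \<le> (\<delta> / 2) ^ L * (n / 2)"
      by linarith
  qed (use \<open>0 < c0\<close> ln_pos in simp)
  then obtain E where E: "E \<subseteq> \<Gamma>" "\<not> has_induced_copy (Kbip_V s r) (Kbip_E s r) n E"
    and card_E: "\<delta> * (real n)\<^sup>2 / (16 * (n / L) powr (1 / s)) \<le> card E"
    by blast
  have "n powr (2 - 1 / s) = n powr 2 / n powr (1 / s)"
    using n by (simp add: powr_diff)
  then have "\<delta> / 16 * (c1 / 2) powr (1 / s) * (n powr (2 - 1 / s) * ln n powr (1 / s))
      = \<delta> / 16 * (real n)\<^sup>2 * ((c1 / 2) powr (1 / s) * ln n powr (1 / s) / n powr (1 / s))"
    using n by simp
  also have "(c1 / 2) powr (1 / s) * ln n powr (1 / s) / n powr (1 / s) = (c1 * ln n / 2 / n) powr (1 / s)"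
    using c1 ln_pos n by (simp add: powr_mult powr_divide)
  also have "\<dots> \<le> (L / n) powr (1 / s)"
    using L(2) c1 ln_pos by (intro powr_mono2 divide_right_mono) auto
  also have "(L / n) powr (1 / s) = 1 / (n / L) powr (1 / s)"
    using L(3) n by (simp add: powr_divide)
  finally have "\<delta> / 16 * (c1 / 2) powr (1 / s) * (n powr (2 - 1 / s) * ln n powr (1 / s))
      \<le> \<delta> / 16 * (real n)\<^sup>2 * (1 / (n / L) powr (1 / s))"
    using \<delta> by (simp add: mult_left_mono)
  also have "\<dots> \<le> card E"
    using card_E by simp
  also have "\<dots> \<le> ex_induced (Kbip_V s r) (Kbip_E s r) n \<Gamma>"
    using ex_induced_geI[OF finite_subset[OF \<Gamma> finite_all_pairs] E] by simp
  finally show ?thesis .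
qed

lemma set_pmf_gnp: "\<Gamma> \<in> set_pmf (gnp n p) \<Longrightarrow> \<Gamma> \<subseteq> all_pairs n"
  by (auto simp: gnp_def)

theorem theorem1p5:
  fixes s :: nat
  assumes "2 \<le> s"
  shows "\<exists>R0::nat. \<forall>r::nat. s \<le> r \<and> R0 \<le> r \<longrightarrow>
           (\<forall>p::real. 0 < p \<and> p < 1 \<longrightarrow>
             (\<exists>c C :: real. 0 < c \<and> 0 < C \<and>
               (\<lambda>n. measure_pmf.prob (gnp n p)
                   {\<Gamma>. c * (real n powr (2 - 1 / real s) * ln (real n) powr (1 / real s))
                         \<le> real (ex_induced (Kbip_V s r) (Kbip_E s r) n \<Gamma>)
                       \<and> real (ex_induced (Kbip_V s r) (Kbip_E s r) n \<Gamma>)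
                         \<le> C * (real n powr (2 - 1 / real s) * ln (real n) powr (1 / real s))})
               \<longlonglongrightarrow> 1))"
proof (intro exI[of _ "s + (s + s * (2 * s + 1)) ^ s + 1"] allI impI)
  \<comment> \<open>The threshold for \<open>r\<close> exceeds by one the sum of \<open>s\<close>
    and the bound on common neighbourhoods in the norm colouring; it depends on \<open>s\<close>
    alone.\<close>
  fix r :: nat and p :: real
  assume r: "s \<le> r \<and> s + (s + s * (2 * s + 1)) ^ s + 1 \<le> r" and p: "0 < p \<and> p < 1"
  \<comment> \<open>The minimum bounds the probabilities of edges and of non-edges from below, so
    one \<open>\<delta>\<close> and one \<open>c0\<close> serve for both.\<close>
  define q where "q = min p (1 - p)"
  have q: "0 < q" "q \<le> 1" "q \<le> pmf (bernoulli_pmf p) b" for b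
    using p by (cases b; auto simp: q_def)+
  define \<delta> where "\<delta> = q / 16"
  define c0 where "c0 = 32 / q"
  define c1 where "c1 = 1 / (2 * ln (2 / \<delta>))"
  have \<delta>: "0 < \<delta>" "\<delta> \<le> 1" and c0: "0 < c0"
    using q by (auto simp: \<delta>_def c0_def)
  have "0 < ln (2 / \<delta>)"
    using \<delta> by simp
  then have c1: "0 < c1" "c1 * ln (2 / \<delta>) = 1 / 2"
    by (simp_all add: c1_def)
  define c where "c = \<delta> / 16 * (c1 / 2) powr (1 / s)"
  define C where "C = 1 + c0 / (\<delta> / 2) ^ r / (\<delta> / 2) ^ (s * s)"
  define good where "good n = {\<Gamma>. c * (real n powr (2 - 1 / real s) * ln (real n) powr (1 / real s))
                         \<le> real (ex_induced (Kbip_V s r) (Kbip_E s r) n \<Gamma>)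
                       \<and> real (ex_induced (Kbip_V s r) (Kbip_E s r) n \<Gamma>)
                         \<le> C * (real n powr (2 - 1 / real s) * ln (real n) powr (1 / real s))}" for n
  define sparse where "sparse b n =
    {\<Gamma>. \<not> dense_rel (\<lambda>u v. u \<noteq> v \<and> ({u, v} \<in> \<Gamma>) = b) \<delta> (c0 * ln (real n)) {..<n}}" for b n
  define \<epsilon> where "\<epsilon> n = (1 / (real n)\<^sup>2 + 1) ^ n - 1" for n
  have s: "0 < s" "s + (s + s * (2 * s + 1)) ^ s < r" "s \<le> r"
    using assms r by auto
  \<comment> \<open>With the exponents abstracted to positive constants, the comparison is purely
    asymptotic: a positive power of \<open>n\<close> beats the logarithm. Positivity of
    \<open>\<alpha>\<close> comes from \<open>2 \<le> s\<close>.\<close>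
  define \<alpha> where "\<alpha> = 1 - 1 / real s"
  define \<gamma> where "\<gamma> = 1 / real s"
  have "0 < \<alpha>" "0 < \<gamma>"
    using assms by (auto simp: \<alpha>_def \<gamma>_def)
  then have ev1: "\<forall>\<^sub>F n::nat in sequentially. c0 / (\<delta> / 2) ^ r * ln n \<le> n powr \<alpha> * ln n powr \<gamma>"
    by real_asymp
  have ev2: "\<forall>\<^sub>F n::nat in sequentially. 2 \<le> c1 * ln n" "\<forall>\<^sub>F n::nat in sequentially. 2 * (c1 * ln n) \<le> n"
    using c1(1) by real_asymp+
  have ev3: "\<forall>\<^sub>F n::nat in sequentially. c0 * ln n \<le> n powr (- (1 / 2)) * (n / 2)"
    using c0 by real_asymp
  have "\<forall>\<^sub>F n in sequentially. 1 - (\<epsilon> n + \<epsilon> n) \<le> measure_pmf.prob (gnp n p) (good n)"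
    using ev1 ev2 ev3 eventually_gt_at_top[of 1]
  proof eventually_elim
    case (elim n)
    have sparse_prob: "measure_pmf.prob (gnp n p) (sparse b n) \<le> \<epsilon> n" for b
      using prob_gnp_not_dense_le[of p q b n] p q elim
      by (simp add: sparse_def \<epsilon>_def \<delta>_def c0_def)
    \<comment> \<open>The deterministic part: dense edges give the lower bound, dense non-edges the
      upper bound.\<close>
    have "\<Gamma> \<in> good n" if "\<Gamma> \<subseteq> all_pairs n" "\<Gamma> \<notin> sparse True n" "\<Gamma> \<notin> sparse False n" for \<Gamma>
      using ex_induced_Kbip_lower[OF that(1) s(1,2) _ \<delta> c0 _ c1]
        ex_induced_Kbip_upper[OF that(1) s(1,3) _ \<delta> c0] that elim
      by (simp add: good_def sparse_def c_def C_def \<alpha>_def \<gamma>_def)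
    then have "1 - measure_pmf.prob (gnp n p) (good n)
        \<le> measure_pmf.prob (gnp n p) (sparse True n \<union> sparse False n)"
      unfolding measure_pmf.prob_compl[of "good n" "gnp n p", symmetric, simplified]
      by (intro measure_pmf.finite_measure_mono_AE) (auto simp: AE_measure_pmf_iff dest: set_pmf_gnp)
    also have "\<dots> \<le> measure_pmf.prob (gnp n p) (sparse True n) + measure_pmf.prob (gnp n p) (sparse False n)"
      by (intro measure_Un_le) auto
    also have "\<dots> \<le> \<epsilon> n + \<epsilon> n"
      by (intro add_mono sparse_prob)
    finally show ?case
      by simp
  qed
  moreover have "(\<lambda>n. 1 - (\<epsilon> n + \<epsilon> n)) \<longlonglongrightarrow> 1 - (0 + 0)"
    unfolding \<epsilon>_def by (intro tendsto_intros union_bound_tendsto_0)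
  ultimately have "(\<lambda>n. measure_pmf.prob (gnp n p) (good n)) \<longlonglongrightarrow> 1"
    by (intro tendsto_sandwich[where g = "\<lambda>n. measure_pmf.prob (gnp n p) (good n)" and h = "\<lambda>_. 1"
          and f = "\<lambda>n. 1 - (\<epsilon> n + \<epsilon> n)"]) auto
  moreover have "0 < c" "0 < C"
    using \<delta> c0 c1 by (auto simp: c_def C_def intro!: add_pos_nonneg)
  ultimately show "\<exists>c C :: real. 0 < c \<and> 0 < C \<and>
               (\<lambda>n. measure_pmf.prob (gnp n p)
                   {\<Gamma>. c * (real n powr (2 - 1 / real s) * ln (real n) powr (1 / real s))
                         \<le> real (ex_induced (Kbip_V s r) (Kbip_E s r) n \<Gamma>)
                       \<and> real (ex_induced (Kbip_V s r) (Kbip_E s r) n \<Gamma>)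
                         \<le> C * (real n powr (2 - 1 / real s) * ln (real n) powr (1 / real s))})
               \<longlonglongrightarrow> 1"
    unfolding good_def by blast
qed

end
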